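(* (i) Let $I = (\eta)$ be a principal ideal such that $r(\eta_a)\asymp \log$ or $\eta \asymp \eta_a$, and let $J$ be an arbitrary ideal. Then $J_{a^2} = I_{a^2}$ implies $J_a = I_a$. (ii) Let $I$ be a general ideal such that every $\xi \in \Sigma(I)$ is dominated termwise by some $\eta \in \Sigma(I)$ for which $r(\eta_a) \asymp \log$ or $\eta \asymp \widehat \eta$. Then for every ideal $J$, $J_{a^2} = I_{a^2}$ implies $J_a = I_a$.
   Context: $H$ is an infinite-dimensional separable complex Hilbert space and $B(H)$ is the algebra of bounded operators on it. $\text{c}_{\text{o}}^*$ is the set of nonnegative real sequences $\xi = (\xi_n)_{n\ge 1}$ that are nonincreasing and converge to $0$. For $m \in \mathbb N$, the ampliation $D_m\xi$ is the sequence in which each entry of $\xi$ is repeated $m$ times. A characteristic set is a positive cone $\Sigma \subset \text{c}_{\text{o}}^*$ (closed under sums and nonnegative scalar multiples) that is hereditary ($0\le\eta \le \xi\in\Sigma$, $\eta\in \text{c}_{\text{o}}^*$, implies $\eta \in \Sigma$) and invariant under all $D_m$. By Calkin's theorem, $I \mapsto \Sigma(I) := \{s(X) \mid X \in I\}$, with $s(X)$ the sequence of $s$-numbers (singular values) of $X$ in decreasing order with multiplicity, completed by zeros if $X$ has finite rank, is an order-preserving bijection from the (proper, two-sided) ideals of $B(H)$ onto the characteristic sets; "ideal" means such an ideal. For $\xi\in \text{c}_{\text{o}}^*$, $(\xi_a)_n := \frac1n\sum_{j=1}^n \xi_j$ and $\xi_{a^2} := (\xi_a)_a$. The arithmetic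 mean ideal $I_a$ of an ideal $I$ is the ideal with $\Sigma(I_a) = \{\xi \in \text{c}_{\text{o}}^* \mid \xi = O(\eta_a) \text{ for some } \eta\in\Sigma(I)\}$, and $I_{a^2} := (I_a)_a$. A principal ideal is an ideal $(\xi)$ with $\xi \in \text{c}_{\text{o}}^*$ and $\Sigma((\xi)) = \{\eta\in\text{c}_{\text{o}}^* \mid \eta = O(D_m\xi)\text{ for some } m \in \mathbb N\}$ (the ideal generated by the diagonal operator with entries $\xi_n$). For $\xi \in \text{c}_{\text{o}}^*$ with all $\xi_n>0$, the ratio of regularity is $r(\xi) := \xi_a/\xi$ (termwise). For $0\neq\eta\in\text{c}_{\text{o}}^*$, $r(\eta_a) = \eta_{a^2}/\eta_a$ is always defined. $r(\eta_a)\asymp\log$ means that $\alpha\log n\le r(\eta_a)_n\le\beta\log n$ for some $\alpha,\beta>0$ and all $n\ge 2$. For two sequences $\xi,\zeta$, $\xi\asymp\zeta$ means $\alpha\zeta_n\le\xi_n\le\beta\zeta_n$ for some $\alpha,\beta>0$ and all $n$. For a non-summable $\xi\in\text{c}_{\text{o}}^*$, $\widehat\xi$ is the sequence $(\widehat\xi)_n := (\xi_a)_{\nu(\xi)_n}$, where $\nu(\xi)_n := \min\{k\in\mathbb N \mid \sum_{i=1}^k\xi_i\ge n\xi_1\}$; the condition $\eta\asymp\widehat\eta$ presupposes that $\eta$ is not summable. *)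

theory Defs
  imports "HOL-Analysis.Analysis"
begin

section \<open>Complex Hilbert spaces\<close>

text \<open>The inner product is linear in the first and conjugate-linear in the second argument.
  Completeness comes from \<^class>\<open>banach\<close>.\<close>

class complex_hilbert = banach +
  fixes scaleC :: "complex \<Rightarrow> 'a \<Rightarrow> 'a"
    and cinner :: "'a \<Rightarrow> 'a \<Rightarrow> complex"
  assumes scaleC_add_right: "scaleC c (x + y) = scaleC c x + scaleC c y"
    and scaleC_add_left: "scaleC (c + d) x = scaleC c x + scaleC d x"
    and scaleC_scaleC: "scaleC c (scaleC d x) = scaleC (c * d) x"
    and scaleC_one: "scaleC 1 x = x"
    and scaleR_scaleC: "scaleR r x = scaleC (complex_of_real r) x"
    and cinner_commute: "cinner x y = cnj (cinner y x)"
    and cinner_add_left: "cinner (x + y) z = cinner x z + cinner y z"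
    and cinner_scaleC_left: "cinner (scaleC c x) y = c * cinner x y"
    and cinner_self: "cinner x x = complex_of_real ((norm x)\<^sup>2)"

global_interpretation complex_vector: vector_space "scaleC :: complex \<Rightarrow> 'a \<Rightarrow> 'a::complex_hilbert"
  by standard (simp_all add: scaleC_add_right scaleC_add_left scaleC_scaleC scaleC_one)

definition separable_infinite_dimensional :: "'h::complex_hilbert itself \<Rightarrow> bool" where
  "separable_infinite_dimensional _ \<longleftrightarrow>
     (\<exists>D::'h set. countable D \<and> closure D = UNIV) \<and>
     \<not> (\<exists>B::'h set. finite B \<and> complex_vector.span B = UNIV)"

section \<open>Bounded operators, singular numbers and ideals\<close>

definition bounded_ops :: "('h::complex_hilbert \<Rightarrow> 'h) set" where
  "bounded_ops = {X. bounded_linear X \<and> (\<forall>c x. X (scaleC c x) = scaleC c (X x))}"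

definition compact_op :: "('h::complex_hilbert \<Rightarrow> 'h) \<Rightarrow> bool" where
  "compact_op X \<longleftrightarrow> X \<in> bounded_ops \<and> compact (closure (X ` cball 0 1))"

definition is_adjoint :: "('h::complex_hilbert \<Rightarrow> 'h) \<Rightarrow> ('h \<Rightarrow> 'h) \<Rightarrow> bool" where
  "is_adjoint X Y \<longleftrightarrow> X \<in> bounded_ops \<and> Y \<in> bounded_ops \<and>
     (\<forall>x y. cinner (X x) y = cinner x (Y y))"

definition eigenspace :: "('h::complex_hilbert \<Rightarrow> 'h) \<Rightarrow> real \<Rightarrow> 'h set" where
  "eigenspace T a = {x. T x = scaleR a x}"

text \<open>Two-sided ideals different from \<open>B(H)\<close>. Closure under scalar multiples follows by composing
  with scalar multiples of the identity. The zero ideal is included.\<close>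

definition proper_ideal :: "('h::complex_hilbert \<Rightarrow> 'h) set \<Rightarrow> bool" where
  "proper_ideal I \<longleftrightarrow> I \<subset> bounded_ops \<and> (\<lambda>_. 0) \<in> I \<and>
     (\<forall>X\<in>I. \<forall>Y\<in>I. (\<lambda>x. X x + Y x) \<in> I) \<and>
     (\<forall>X\<in>I. \<forall>A\<in>bounded_ops. A \<circ> X \<in> I \<and> X \<circ> A \<in> I)"

text \<open>Sequences \<open>(\<xi>\<^sub>n)\<close>, \<open>n \<ge> 1\<close>, are represented as functions on \<^typ>\<open>nat\<close> with the index
  shifted by one: \<open>\<xi> n\<close> stands for the entry with number \<open>n + 1\<close>.\<close>

definition c0_star :: "(nat \<Rightarrow> real) set" where
  "c0_star = {\<xi>. (\<forall>n. 0 \<le> \<xi> n) \<and> decseq \<xi> \<and> \<xi> \<longlonglongrightarrow> 0}"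

text \<open>\<open>is_s_numbers X s\<close>: \<open>X\<close> is compact and \<open>s = s(X)\<close> lists the nonzero singular values
  of \<open>X\<close> (the square roots of the eigenvalues of \<open>X\<^sup>*X\<close>) in decreasing order with
  multiplicity, completed by zeros if there are only finitely many. Since \<open>X\<close> is compact, the
  eigenspaces for \<open>t > 0\<close> are finite-dimensional, so the convention that \<open>dim\<close> and \<open>card\<close>
  are 0 in the infinite case plays no role. Every operator in a proper ideal of \<open>B(H)\<close>, \<open>H\<close>
  separable, is compact.\<close>

definition is_s_numbers :: "('h::complex_hilbert \<Rightarrow> 'h) \<Rightarrow> (nat \<Rightarrow> real) \<Rightarrow> bool" where
  "is_s_numbers X s \<longleftrightarrow> compact_op X \<and> s \<in> c0_star \<and>
     (\<exists>Y. is_adjoint X Y \<and>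
        (\<forall>t>0. card {n. s n = t} = complex_vector.dim (eigenspace (Y \<circ> X) (t\<^sup>2))))"

definition char_set :: "('h::complex_hilbert \<Rightarrow> 'h) set \<Rightarrow> (nat \<Rightarrow> real) set" where
  "char_set I = {s. \<exists>X\<in>I. is_s_numbers X s}"

text \<open>The inverse of the Calkin correspondence \<open>I \<mapsto> char_set I\<close>: the ideal with
  characteristic set \<open>S\<close>, for a characteristic set \<open>S\<close>.\<close>

definition ideal_of :: "(nat \<Rightarrow> real) set \<Rightarrow> ('h::complex_hilbert \<Rightarrow> 'h) set" where
  "ideal_of S = {X. \<exists>s\<in>S. is_s_numbers X s}"

section \<open>Arithmetic means\<close>

definition ampliation :: "nat \<Rightarrow> (nat \<Rightarrow> real) \<Rightarrow> nat \<Rightarrow> real" where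
  "ampliation m \<xi> n = \<xi> (n div m)"

definition amean :: "(nat \<Rightarrow> real) \<Rightarrow> nat \<Rightarrow> real" where
  "amean \<xi> n = (\<Sum>j\<le>n. \<xi> j) / real (n + 1)"

text \<open>For nonnegative sequences; the bound is required for all \<open>n\<close> rather than eventually, so
  that only the zero sequence is \<open>O(0)\<close>.\<close>

definition seq_bigo :: "(nat \<Rightarrow> real) \<Rightarrow> (nat \<Rightarrow> real) \<Rightarrow> bool" where
  "seq_bigo \<xi> \<eta> \<longleftrightarrow> (\<exists>C. \<forall>n. \<xi> n \<le> C * \<eta> n)"

definition seq_equiv :: "(nat \<Rightarrow> real) \<Rightarrow> (nat \<Rightarrow> real) \<Rightarrow> bool" where
  "seq_equiv \<xi> \<zeta> \<longleftrightarrow>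
     (\<exists>\<alpha>>0. \<exists>\<beta>>0. \<forall>n. \<alpha> * \<zeta> n \<le> \<xi> n \<and> \<xi> n \<le> \<beta> * \<zeta> n)"

definition am_ideal :: "('h::complex_hilbert \<Rightarrow> 'h) set \<Rightarrow> ('h \<Rightarrow> 'h) set" where
  "am_ideal I = ideal_of {\<xi> \<in> c0_star. \<exists>\<eta>\<in>char_set I. seq_bigo \<xi> (amean \<eta>)}"

definition is_principal_ideal :: "('h::complex_hilbert \<Rightarrow> 'h) set \<Rightarrow> (nat \<Rightarrow> real) \<Rightarrow> bool" where
  "is_principal_ideal I \<xi> \<longleftrightarrow> proper_ideal I \<and> \<xi> \<in> c0_star \<and>
     char_set I = {\<eta> \<in> c0_star. \<exists>m\<ge>1. seq_bigo \<eta> (ampliation m \<xi>)}"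

definition regularity_ratio :: "(nat \<Rightarrow> real) \<Rightarrow> nat \<Rightarrow> real" where
  "regularity_ratio \<xi> n = amean \<xi> n / \<xi> n"

text \<open>\<open>r(\<eta>\<^sub>a) \<asymp> log\<close>; the range \<open>n \<ge> 1\<close> and the argument \<open>n + 1\<close> of the logarithm
  are due to the index shift.\<close>

definition ratio_equiv_log :: "(nat \<Rightarrow> real) \<Rightarrow> bool" where
  "ratio_equiv_log \<eta> \<longleftrightarrow> \<eta> \<noteq> (\<lambda>_. 0) \<and>
     (\<exists>\<alpha>>0. \<exists>\<beta>>0. \<forall>n\<ge>1.
        \<alpha> * ln (real (n + 1)) \<le> regularity_ratio (amean \<eta>) n \<and>
        regularity_ratio (amean \<eta>) n \<le> \<beta> * ln (real (n + 1)))"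

text \<open>In shifted indices, \<open>hat_index \<xi> n\<close> is \<open>\<nu>(\<xi>)\<close> at number \<open>n + 1\<close>, minus one.\<close>

definition hat_index :: "(nat \<Rightarrow> real) \<Rightarrow> nat \<Rightarrow> nat" where
  "hat_index \<xi> n = (LEAST k. (\<Sum>i\<le>k. \<xi> i) \<ge> real (n + 1) * \<xi> 0)"

definition hat :: "(nat \<Rightarrow> real) \<Rightarrow> nat \<Rightarrow> real" where
  "hat \<xi> n = amean \<xi> (hat_index \<xi> n)"

definition equiv_hat :: "(nat \<Rightarrow> real) \<Rightarrow> bool" where
  "equiv_hat \<eta> \<longleftrightarrow> \<not> summable \<eta> \<and> seq_equiv \<eta> (hat \<eta>)"

end

theory Submission
  imports Defs
begin

text \<open>
  Two facts about operators reduce the theorem to sequences. An operator determines its singular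
  numbers, because its adjoint is unique and two decreasing null sequences that attain every
  positive value equally often coincide (\<open>is_s_numbers_unique\<close>). Conversely every null sequence
  \<open>s\<close> in \<open>c0_star\<close> is realized by the diagonal operator with entries \<open>s\<close> along an orthonormal
  sequence (\<open>is_s_numbers_diag_op\<close>). Hence the arithmetic mean of ideals becomes the operation
  \<open>am_set\<close> on sets of sequences, and the second mean of \<open>S\<close> consists of all
  \<open>\<xi> = O(\<eta>\<^sub>a\<^sub>a)\<close> with \<open>\<eta> \<in> S\<close>.

  What is left is to compare first means of two sequences whose second means are comparable. Write
  \<open>P\<close>, \<open>Q\<close> for the partial sums of \<open>\<zeta>\<close>, \<open>\<eta>\<close> and \<open>h\<close> for the harmonic numbers. The sums
  \<open>L\<close> of \<open>\<zeta>\<^sub>a\<close> over \<open>(n, m]\<close> lie between \<open>P(n) (h(m) - h(n))\<close> and \<open>P(m) (h(m) - h(n))\<close>, since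
  \<open>P\<close> increases. Every comparison chooses \<open>n\<close> and \<open>m\<close> well in these two bounds.

  If the ratio of regularity of \<open>\<eta>\<^sub>a\<close> is at least a multiple \<open>a\<close> of the logarithm, then \<open>\<eta>\<^sub>a\<^sub>a\<close>
  is as large as it can be, as \<open>\<zeta>\<^sub>a\<^sub>a \<le> h \<zeta>\<^sub>a\<close> for every \<open>\<zeta>\<close>; this gives
  \<open>\<eta>\<^sub>a = O(\<zeta>\<^sub>a)\<close> from \<open>\<eta>\<^sub>a\<^sub>a = O(\<zeta>\<^sub>a\<^sub>a)\<close>. For the opposite comparison take \<open>m\<close> so much larger than
  \<open>n\<close> that \<open>h(m) - h(n)\<close> is a small but fixed fraction of \<open>h(m)\<close>: then \<open>P(n)\<close> already forces
  \<open>\<zeta>\<^sub>a\<^sub>a(m)\<close> to be large, while \<open>Q(m) = O(Q(n))\<close>.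

  If \<open>\<eta>\<close> is regular, that is \<open>\<eta>\<^sub>a = O(\<eta>)\<close>, then \<open>\<zeta>\<^sub>a\<^sub>a = O(\<eta>\<^sub>a\<^sub>a)\<close> gives \<open>\<zeta>\<^sub>a = O(\<eta>\<^sub>a)\<close> at once.
  If in addition \<open>\<eta>\<^sub>a\<^sub>a = O(\<zeta>\<^sub>a\<^sub>a)\<close>, let \<open>n\<close> precede \<open>m\<close> by a large constant harmonic distance.
  Regularity makes the sum of \<open>\<eta>\<^sub>a\<close> up to \<open>n\<close> a small part of that up to \<open>m\<close>, the same then holds
  for \<open>\<zeta>\<^sub>a\<close>, and the remaining part is at most a constant times \<open>P(m)\<close>. This settles principal
  ideals.

  In the second statement the sequences bounding \<open>\<zeta>\<^sub>a\<^sub>a\<close> from above and below need not be the same,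
  so one-sided comparisons are required. They hold if \<open>\<eta>\<close> is equivalent to its hat. First, such an
  \<open>\<eta>\<close> is regular: it varies so slowly that \<open>\<eta>(n div M) \<le> c \<eta>(n)\<close> for large \<open>n\<close>, with \<open>c\<close> not
  depending on \<open>M\<close> (\<open>le_of_bigo_hat\<close>, \<open>regular_of_bigo_hat\<close>). Second, \<open>\<eta>\<^sub>a\<^sub>a = O(\<zeta>\<^sub>a\<^sub>a)\<close> bounds
  the hat of \<open>\<eta>\<close>, hence \<open>\<eta>\<close>, by a multiple of \<open>\<zeta>\<^sub>a\<close>, and regularity turns this into
  \<open>\<eta>\<^sub>a = O(\<zeta>\<^sub>a)\<close>.
\<close>

section \<open>Decreasing null sequences\<close>

lemma c0_starD:
  assumes "\<xi> \<in> c0_star"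
  shows c0_star_nonneg: "0 \<le> \<xi> n" and c0_star_antimono: "m \<le> n \<Longrightarrow> \<xi> n \<le> \<xi> m"
    and c0_star_tendsto: "\<xi> \<longlonglongrightarrow> 0"
  using assms by (auto simp: c0_star_def decseq_def)

lemma finite_level_set_c0_star:
  assumes "s \<in> c0_star" "t > 0"
  shows "finite {n. s n = t}"
proof -
  have "\<forall>\<^sub>F n in sequentially. s n < t"
    using assms by (intro order_tendstoD) (auto intro: c0_star_tendsto)
  then obtain N where "\<And>n. n \<ge> N \<Longrightarrow> s n < t" by (auto simp: eventually_sequentially)
  then have "{n. s n = t} \<subseteq> {..<N}" by (auto simp: not_less[symmetric])
  then show ?thesis using finite_subset by blast
qed

section \<open>Inner product geometry\<close>

lemma cinner_add_right: "cinner x (y + z) = cinner x y + cinner x z"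
  by (metis cinner_add_left cinner_commute complex_cnj_add)

lemma cinner_scaleC_right: "cinner x (scaleC c y) = cnj c * cinner x y"
  by (metis cinner_commute cinner_scaleC_left complex_cnj_mult)

lemma cinner_zero_left [simp]: "cinner 0 x = 0"
  using cinner_scaleC_left[of 0 0 x] by simp

lemma cinner_zero_right [simp]: "cinner x 0 = 0"
  by (metis cinner_commute cinner_zero_left complex_cnj_zero)

lemma cinner_diff_left: "cinner (x - y) z = cinner x z - cinner y z"
  using cinner_add_left[of "x - y" y z] by simp

lemma cinner_diff_right: "cinner x (y - z) = cinner x y - cinner x z"
  using cinner_add_right[of x "y - z" z] by simp

lemma cinner_sum_left: "cinner (sum f A) x = (\<Sum>i\<in>A. cinner (f i) x)"
  by (induction A rule: infinite_finite_induct) (simp_all add: cinner_add_left)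

lemma cinner_sum_right: "cinner x (sum f A) = (\<Sum>i\<in>A. cinner x (f i))"
  by (induction A rule: infinite_finite_induct) (simp_all add: cinner_add_right)

lemma cinner_eqI: "y = z" if "\<And>x. cinner x y = cinner x z"
proof -
  have "cinner (y - z) (y - z) = 0"
    using that by (simp add: cinner_diff_right)
  then show ?thesis by (simp add: cinner_self)
qed

lemma norm_scaleC: "norm (scaleC c x) = cmod c * norm x"
proof -
  have "complex_of_real ((norm (scaleC c x))\<^sup>2) = c * cnj c * complex_of_real ((norm x)\<^sup>2)"
    unfolding cinner_self[symmetric] by (simp add: cinner_scaleC_left cinner_scaleC_right)
  also have "\<dots> = complex_of_real ((cmod c * norm x)\<^sup>2)"
    by (simp add: power_mult_distrib flip: complex_norm_square)
  finally have "(norm (scaleC c x))\<^sup>2 = (cmod c * norm x)\<^sup>2"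
    using of_real_eq_iff by blast
  then show ?thesis by (simp add: power2_eq_iff_nonneg)
qed

lemma norm_add_square_orthogonal:
  "(norm (x + y))\<^sup>2 = (norm x)\<^sup>2 + (norm y)\<^sup>2" if "cinner x y = 0"
proof -
  have "cinner y x = 0" using that by (metis cinner_commute complex_cnj_zero)
  then have "complex_of_real ((norm (x + y))\<^sup>2) = complex_of_real ((norm x)\<^sup>2 + (norm y)\<^sup>2)"
    unfolding of_real_add cinner_self[symmetric] using that
    by (simp add: cinner_add_left cinner_add_right)
  then show ?thesis using of_real_eq_iff by blast
qed

text \<open>Split \<open>x\<close> into its projection on \<open>y\<close> and an orthogonal rest and compare norms.\<close>

lemma cauchy_schwarz: "cmod (cinner x y) \<le> norm x * norm y"
proof (cases "y = 0")
  case False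
  define c where "c = cinner x y / complex_of_real ((norm y)\<^sup>2)"
  have "cinner (x - scaleC c y) y = 0"
    using False by (simp add: cinner_diff_left cinner_scaleC_left cinner_self c_def)
  then have "cinner (x - scaleC c y) (scaleC c y) = 0"
    by (simp add: cinner_scaleC_right)
  from norm_add_square_orthogonal[OF this]
  have "(norm (scaleC c y))\<^sup>2 \<le> (norm x)\<^sup>2" by simp
  then have "cmod c * norm y \<le> norm x"
    by (simp add: norm_scaleC power2_le_iff_abs_le abs_mult)
  moreover have "cmod c * norm y * norm y = cmod (cinner x y)"
    using False by (simp add: c_def norm_divide norm_power power2_eq_square norm_mult)
  ultimately show ?thesis
    by (metis mult_right_mono norm_ge_zero)
qed simp

lemma bounded_linear_cinner_left: "bounded_linear (\<lambda>x. cinner x y)"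
proof (rule bounded_linear_intro[where K = "norm y"])
  show "cinner (scaleR r x) y = scaleR r (cinner x y)" for r x
    by (simp add: scaleR_scaleC cinner_scaleC_left scaleR_conv_of_real)
qed (simp_all add: cinner_add_left cauchy_schwarz)

lemma bounded_linear_scaleC_right: "bounded_linear (scaleC c)"
proof (rule bounded_linear_intro[where K = "cmod c"])
  show "scaleC c (scaleR r x) = scaleR r (scaleC c x)" for r x
    by (simp add: scaleR_scaleC scaleC_scaleC mult.commute)
qed (simp_all add: scaleC_add_right norm_scaleC mult.commute)

lemma bounded_linear_scaleC_left: "bounded_linear (\<lambda>c. scaleC c x)"
proof (rule bounded_linear_intro[where K = "norm x"])
  show "scaleC (scaleR r c) x = scaleR r (scaleC c x)" for r c
    by (simp add: scaleR_scaleC scaleC_scaleC scaleR_conv_of_real)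
qed (simp_all add: scaleC_add_left norm_scaleC mult.commute)

section \<open>Orthonormal sequences\<close>

definition orthonormal_seq :: "(nat \<Rightarrow> 'h::complex_hilbert) \<Rightarrow> bool" where
  "orthonormal_seq e \<longleftrightarrow> (\<forall>m n. cinner (e m) (e n) = (if m = n then 1 else 0))"

text \<open>One step of Gram--Schmidt: the finitely many given vectors do not span the space, so a vector
  outside their span has a nonzero component orthogonal to all of them.\<close>

lemma exists_unit_vector_orthogonal:
  fixes e :: "nat \<Rightarrow> 'h::complex_hilbert"
  assumes inf: "\<not> (\<exists>B::'h set. finite B \<and> complex_vector.span B = UNIV)"
    and on: "\<And>i j. i < n \<Longrightarrow> j < n \<Longrightarrow> cinner (e i) (e j) = (if i = j then 1 else 0)"
  shows "\<exists>v. norm v = 1 \<and> (\<forall>i<n. cinner v (e i) = 0)"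
proof -
  have "complex_vector.span (e ` {..<n}) \<noteq> UNIV" using inf by blast
  then obtain v where v: "v \<notin> complex_vector.span (e ` {..<n})" by blast
  define p where "p = (\<Sum>i<n. scaleC (cinner v (e i)) (e i))"
  have "p \<in> complex_vector.span (e ` {..<n})"
    unfolding p_def
    by (intro complex_vector.span_sum complex_vector.span_scale complex_vector.span_base) auto
  then have ne: "v - p \<noteq> 0" using v by auto
  have orth: "cinner (v - p) (e i) = 0" if "i < n" for i
  proof -
    have "cinner p (e i) = (\<Sum>j<n. if j = i then cinner v (e i) else 0)"
      unfolding p_def cinner_sum_left
      by (rule sum.cong) (use on that in \<open>auto simp: cinner_scaleC_left\<close>)
    then show ?thesis using that by (simp add: cinner_diff_left)
  qed
  define w where "w = scaleC (complex_of_real (1 / norm (v - p))) (v - p)"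
  have "norm w = 1" using ne by (simp add: w_def norm_scaleC norm_divide)
  moreover have "\<forall>i<n. cinner w (e i) = 0"
    using orth by (simp add: w_def cinner_scaleC_left)
  ultimately show ?thesis by blast
qed

lemma exists_orthonormal_seq:
  assumes inf: "\<not> (\<exists>B::'h::complex_hilbert set. finite B \<and> complex_vector.span B = UNIV)"
  shows "\<exists>e::nat \<Rightarrow> 'h. orthonormal_seq e"
proof -
  \<comment> \<open>Recursive choice: the new vector \<open>r\<close> against the vectors \<open>f i\<close> already chosen.\<close>
  define P where "P f n r \<longleftrightarrow> norm r = 1 \<and> (\<forall>i<n. cinner r (f i) = 0)"
    for f :: "nat \<Rightarrow> 'h" and n r
  have ortho: "cinner (f i) (f j) = (if i = j then 1 else 0)"
    if "\<And>m. m < n \<Longrightarrow> P f m (f m)" "i < n" "j < n" for f n i j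
  proof (cases i j rule: linorder_cases)
    case equal
    then show ?thesis using that(1)[of i] that(2) by (simp add: P_def cinner_self)
  next
    case less
    then have "cinner (f j) (f i) = 0" using that(1)[of j] that(3) by (simp add: P_def)
    then show ?thesis using less by (metis cinner_commute complex_cnj_zero nat_neq_iff)
  next
    case greater
    then show ?thesis using that(1)[of i] that(2) by (simp add: P_def)
  qed
  have "\<exists>f. \<forall>n. P f n (f n)"
  proof (rule dependent_wellorder_choice)
    show "P f x r = P g x r" if "\<And>y. y < x \<Longrightarrow> f y = g y" for r f g x
      using that by (simp add: P_def)
    show "\<exists>r. P f x r" if "\<And>y. y < x \<Longrightarrow> P f y (f y)" for x f
      unfolding P_def by (rule exists_unit_vector_orthogonal[OF inf ortho[OF that]])
  qed
  then obtain f where "\<And>n. P f n (f n)" by blast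
  then have "orthonormal_seq f"
    unfolding orthonormal_seq_def by (metis ortho lessI max_less_iff_conj)
  then show ?thesis by blast
qed

lemma norm_orthonormal: "norm (e n) = 1" if "orthonormal_seq e"
proof -
  have "complex_of_real ((norm (e n))\<^sup>2) = complex_of_real 1"
    using that unfolding cinner_self[symmetric] by (simp add: orthonormal_seq_def)
  then have "(norm (e n))\<^sup>2 = 1" using of_real_eq_iff by blast
  then show ?thesis using power2_eq_iff_nonneg[of "norm (e n)" 1] by simp
qed

lemma norm_orthonormal_sum_square:
  assumes "orthonormal_seq e" "finite F"
  shows "(norm (\<Sum>n\<in>F. scaleC (c n) (e n)))\<^sup>2 = (\<Sum>n\<in>F. (cmod (c n))\<^sup>2)"
  using assms(2)
proof (induction F rule: finite_induct)
  case (insert m F)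
  have "cinner (scaleC (c m) (e m)) (\<Sum>n\<in>F. scaleC (c n) (e n)) = 0"
    unfolding cinner_sum_right
    by (rule sum.neutral)
      (use insert.hyps assms(1) in \<open>auto simp: cinner_scaleC_left cinner_scaleC_right orthonormal_seq_def\<close>)
  then show ?case
    using insert by (simp add: norm_add_square_orthogonal norm_scaleC norm_orthonormal[OF assms(1)])
qed simp

lemma bessel:
  assumes e: "orthonormal_seq e" and "finite F"
  shows "(\<Sum>n\<in>F. (cmod (cinner x (e n)))\<^sup>2) \<le> (norm x)\<^sup>2"
proof -
  define p where "p = (\<Sum>n\<in>F. scaleC (cinner x (e n)) (e n))"
  have orth: "cinner (x - p) (e i) = 0" if "i \<in> F" for i
  proof -
    have "cinner p (e i) = (\<Sum>j\<in>F. if j = i then cinner x (e i) else 0)"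
      unfolding p_def cinner_sum_left
      by (rule sum.cong) (use e in \<open>auto simp: cinner_scaleC_left orthonormal_seq_def\<close>)
    then show ?thesis using that \<open>finite F\<close> by (simp add: cinner_diff_left)
  qed
  then have "cinner (x - p) p = 0"
    by (subst (2) p_def) (simp add: cinner_sum_right cinner_scaleC_right)
  from norm_add_square_orthogonal[OF this] have "(norm p)\<^sup>2 \<le> (norm x)\<^sup>2" by simp
  then show ?thesis
    unfolding p_def norm_orthonormal_sum_square[OF assms] .
qed

section \<open>Diagonal operators\<close>

definition diag_op :: "(nat \<Rightarrow> 'h::complex_hilbert) \<Rightarrow> (nat \<Rightarrow> real) \<Rightarrow> 'h \<Rightarrow> 'h" where
  "diag_op e s x = (\<Sum>n. scaleC (complex_of_real (s n) * cinner x (e n)) (e n))"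

text \<open>By Bessel's inequality the sum over \<open>F\<close> is bounded by the largest entry met in \<open>F\<close>. As the
  entries tend to 0, this one estimate yields convergence of the series, boundedness of the operator,
  and approximation in norm by finite sums.\<close>

lemma norm_diag_sum_le:
  assumes e: "orthonormal_seq e" and F: "finite F"
    and s: "\<And>n. n \<in> F \<Longrightarrow> 0 \<le> s n" "\<And>n. n \<in> F \<Longrightarrow> s n \<le> b" and b: "0 \<le> b"
  shows "norm (\<Sum>n\<in>F. scaleC (complex_of_real (s n) * cinner x (e n)) (e n)) \<le> b * norm x"
proof -
  have "(norm (\<Sum>n\<in>F. scaleC (complex_of_real (s n) * cinner x (e n)) (e n)))\<^sup>2
      = (\<Sum>n\<in>F. (s n)\<^sup>2 * (cmod (cinner x (e n)))\<^sup>2)"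
    unfolding norm_orthonormal_sum_square[OF e F] by (simp add: norm_mult power_mult_distrib)
  also have "\<dots> \<le> (\<Sum>n\<in>F. b\<^sup>2 * (cmod (cinner x (e n)))\<^sup>2)"
    by (intro sum_mono mult_right_mono power_mono) (use s in auto)
  also have "\<dots> \<le> b\<^sup>2 * (norm x)\<^sup>2"
    unfolding sum_distrib_left[symmetric] by (intro mult_left_mono bessel e F) auto
  finally show ?thesis
    using b by (simp add: power_mult_distrib[symmetric] power2_le_iff_abs_le)
qed

text \<open>The images of the unit ball under the finite-rank truncations of a diagonal operator lie in such
  sets \<open>K\<close>, which are iterated sums of compact discs.\<close>

lemma compact_bounded_combinations:
  fixes e :: "nat \<Rightarrow> 'h::complex_hilbert"
  shows "\<exists>K. compact K \<and> (\<forall>c. (\<forall>n<N. cmod (c n) \<le> b) \<longrightarrow> (\<Sum>n<N. scaleC (c n) (e n)) \<in> K)"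
proof (induction N)
  case 0
  show ?case by (intro exI[of _ "{0}"]) auto
next
  case (Suc N)
  then obtain K where K: "compact K" "\<And>c. (\<forall>n<N. cmod (c n) \<le> b) \<Longrightarrow> (\<Sum>n<N. scaleC (c n) (e n)) \<in> K"
    by blast
  define L where "L = (\<lambda>c. scaleC c (e N)) ` cball 0 b"
  have "compact L"
    unfolding L_def
    by (intro compact_continuous_image linear_continuous_on bounded_linear_scaleC_left) auto
  then have "compact {x + y | x y. x \<in> K \<and> y \<in> L}"
    using K(1) by (rule compact_sums[rotated])
  moreover have "(\<Sum>n<Suc N. scaleC (c n) (e n)) \<in> {x + y | x y. x \<in> K \<and> y \<in> L}"
    if "\<forall>n<Suc N. cmod (c n) \<le> b" for c
  proof -
    have "(\<Sum>n<N. scaleC (c n) (e n)) \<in> K" "scaleC (c N) (e N) \<in> L"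
      using K(2)[of c] that by (auto simp: L_def)
    then show ?thesis by auto
  qed
  ultimately show ?case by blast
qed

context
  fixes e :: "nat \<Rightarrow> 'h::complex_hilbert" and s :: "nat \<Rightarrow> real"
  assumes e: "orthonormal_seq e" and s: "s \<in> c0_star"
begin

lemmas s_nonneg = c0_star_nonneg[OF s]
lemmas s_dec = c0_star_antimono[OF s]
lemmas s_lim = c0_star_tendsto[OF s]

lemma diag_sums: "(\<lambda>n. scaleC (complex_of_real (s n) * cinner x (e n)) (e n)) sums diag_op e s x"
proof -
  have "summable (\<lambda>n. scaleC (complex_of_real (s n) * cinner x (e n)) (e n))"
    unfolding summable_Cauchy
  proof (intro allI impI)
    fix r :: real assume "r > 0"
    have "(\<lambda>n. s n * norm x) \<longlonglongrightarrow> 0 * norm x" by (intro tendsto_intros s_lim)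
    then have "\<forall>\<^sub>F n in sequentially. s n * norm x < r"
      using \<open>r > 0\<close> by (intro order_tendstoD) auto
    then obtain N where N: "s N * norm x < r"
      by (auto simp: eventually_sequentially)
    have "norm (\<Sum>k\<in>{m..<n}. scaleC (complex_of_real (s k) * cinner x (e k)) (e k)) < r"
      if "m \<ge> N" for m n
    proof -
      have "norm (\<Sum>k\<in>{m..<n}. scaleC (complex_of_real (s k) * cinner x (e k)) (e k)) \<le> s N * norm x"
        by (rule norm_diag_sum_le[OF e]) (use that s_nonneg in \<open>auto intro: s_dec\<close>)
      with N show ?thesis by simp
    qed
    then show "\<exists>N. \<forall>m\<ge>N. \<forall>n. norm (\<Sum>k\<in>{m..<n}. scaleC (complex_of_real (s k) * cinner x (e k)) (e k)) < r"
      by blast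
  qed
  then show ?thesis unfolding diag_op_def by (rule summable_sums)
qed

lemma diag_op_tail:
  "norm (diag_op e s x - (\<Sum>n<N. scaleC (complex_of_real (s n) * cinner x (e n)) (e n))) \<le> s N * norm x"
proof -
  let ?f = "\<lambda>n. scaleC (complex_of_real (s n) * cinner x (e n)) (e n)"
  have "(\<lambda>n. norm (sum ?f {..<n} - sum ?f {..<N})) \<longlonglongrightarrow> norm (diag_op e s x - sum ?f {..<N})"
    using diag_sums[of x] unfolding sums_def by (intro tendsto_intros)
  moreover have "norm (sum ?f {..<n} - sum ?f {..<N}) \<le> s N * norm x" if "n \<ge> N" for n
  proof -
    have "sum ?f {..<n} - sum ?f {..<N} = sum ?f {N..<n}"
      using that sum_diff_nat_ivl[of 0 N n ?f] by (simp add: atLeast0LessThan)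
    then show ?thesis
      using norm_diag_sum_le[OF e, of "{N..<n}" s "s N" x] s_nonneg s_dec by auto
  qed
  ultimately show ?thesis by (intro LIMSEQ_le_const2) auto
qed

lemma diag_op_add: "diag_op e s (x + y) = diag_op e s x + diag_op e s y"
  using sums_add[OF diag_sums[of x] diag_sums[of y]] diag_sums[of "x + y"]
  by (intro sums_unique2) (auto simp: cinner_add_left distrib_left scaleC_add_left)

lemma diag_op_scaleC: "diag_op e s (scaleC c x) = scaleC c (diag_op e s x)"
proof -
  have "(\<lambda>n. scaleC c (scaleC (complex_of_real (s n) * cinner x (e n)) (e n))) sums scaleC c (diag_op e s x)"
    by (rule bounded_linear.sums[OF bounded_linear_scaleC_right diag_sums])
  then show ?thesis
    using diag_sums[of "scaleC c x"]
    by (intro sums_unique2) (auto simp: cinner_scaleC_left scaleC_scaleC mult.left_commute)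
qed

lemma diag_op_bounded: "diag_op e s \<in> bounded_ops"
proof -
  have "bounded_linear (diag_op e s)"
  proof (rule bounded_linear_intro[where K = "s 0"])
    show "norm (diag_op e s x) \<le> norm x * s 0" for x
      using diag_op_tail[of x 0] by (simp add: mult.commute)
  qed (simp_all add: diag_op_add diag_op_scaleC scaleR_scaleC)
  then show ?thesis by (simp add: bounded_ops_def diag_op_scaleC)
qed

lemma cinner_diag_op_sums:
  "(\<lambda>n. complex_of_real (s n) * cinner x (e n) * cinner (e n) y) sums cinner (diag_op e s x) y"
  using bounded_linear.sums[OF bounded_linear_cinner_left[of y] diag_sums[of x]]
  by (simp add: cinner_scaleC_left)

lemma diag_op_self_adjoint: "is_adjoint (diag_op e s) (diag_op e s)"
proof -
  have "cinner (diag_op e s x) y = cinner x (diag_op e s y)" for x y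
  proof -
    have "(\<lambda>n. cnj (complex_of_real (s n) * cinner y (e n) * cinner (e n) x))
        sums cnj (cinner (diag_op e s y) x)"
      by (rule bounded_linear.sums[OF bounded_linear_cnj cinner_diag_op_sums])
    moreover have "(\<lambda>n. cnj (complex_of_real (s n) * cinner y (e n) * cinner (e n) x))
        = (\<lambda>n. complex_of_real (s n) * cinner x (e n) * cinner (e n) y)"
    proof
      show "cnj (complex_of_real (s n) * cinner y (e n) * cinner (e n) x)
          = complex_of_real (s n) * cinner x (e n) * cinner (e n) y" for n
        using cinner_commute[of x "e n"] cinner_commute[of "e n" y] by simp
    qed
    ultimately have "(\<lambda>n. complex_of_real (s n) * cinner x (e n) * cinner (e n) y)
        sums cinner x (diag_op e s y)"
      using cinner_commute[of x "diag_op e s y"] by metis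
    then show ?thesis using cinner_diag_op_sums sums_unique2 by blast
  qed
  then show ?thesis by (simp add: is_adjoint_def diag_op_bounded)
qed

lemma diag_op_finite_support:
  assumes "finite A" "\<And>n. n \<notin> A \<Longrightarrow> cinner x (e n) = 0"
  shows "diag_op e s x = (\<Sum>n\<in>A. scaleC (complex_of_real (s n) * cinner x (e n)) (e n))"
  unfolding diag_op_def by (rule suminf_finite) (use assms in auto)

lemma diag_op_basis: "diag_op e s (e n) = scaleC (complex_of_real (s n)) (e n)"
  using diag_op_finite_support[of "{n}" "e n"] e by (simp add: orthonormal_seq_def)

lemma cinner_diag_op_basis: "cinner (diag_op e s x) (e n) = complex_of_real (s n) * cinner x (e n)"
  using diag_op_self_adjoint
  by (simp add: is_adjoint_def diag_op_basis cinner_scaleC_right)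

text \<open>The coefficient of an eigenvector at \<open>e n\<close> is multiplied by \<open>(s n)\<^sup>2\<close> as well as by \<open>t\<^sup>2\<close>, so only
  indices with \<open>s n = t\<close> survive. The eigenvector itself lies in the span because it is \<open>t\<^sup>-\<^sup>2\<close> times
  an image under the diagonal operator; the part of the space orthogonal to the whole sequence \<open>e\<close>
  is annihilated and does not contribute for \<open>t > 0\<close>.\<close>

lemma eigenspace_diag_op:
  assumes "t > 0"
  shows "eigenspace (diag_op e s \<circ> diag_op e s) (t\<^sup>2) = complex_vector.span (e ` {n. s n = t})"
    (is "?E = complex_vector.span ?B")
proof
  have fin: "finite {n. s n = t}" using s assms by (rule finite_level_set_c0_star)
  have lin: "diag_op e s (x + y) = diag_op e s x + diag_op e s y"
    "diag_op e s (scaleC c x) = scaleC c (diag_op e s x)" for x y c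
    by (rule diag_op_add diag_op_scaleC)+
  have "complex_vector.subspace ?E"
  proof (rule complex_vector.subspaceI)
    show "0 \<in> ?E" using lin(2)[of 0 0] by (simp add: eigenspace_def)
  qed (auto simp: eigenspace_def lin scaleR_scaleC scaleC_add_right scaleC_scaleC mult.commute)
  moreover have "?B \<subseteq> ?E"
    by (auto simp: eigenspace_def diag_op_basis lin scaleR_scaleC scaleC_scaleC power2_eq_square)
  ultimately show "complex_vector.span ?B \<subseteq> ?E"
    by (rule complex_vector.span_minimal[rotated])
  show "?E \<subseteq> complex_vector.span ?B"
  proof
    fix x assume "x \<in> ?E"
    then have x: "diag_op e s (diag_op e s x) = scaleC (complex_of_real (t\<^sup>2)) x"
      by (simp add: eigenspace_def scaleR_scaleC)
    have zero: "cinner (diag_op e s x) (e n) = 0" if "s n \<noteq> t" for n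
    proof -
      have "complex_of_real (s n) * (complex_of_real (s n) * cinner x (e n))
          = complex_of_real (t\<^sup>2) * cinner x (e n)"
        using arg_cong[OF x, of "\<lambda>y. cinner y (e n)"]
        by (simp add: cinner_diag_op_basis cinner_scaleC_left)
      then have "complex_of_real ((s n)\<^sup>2 - t\<^sup>2) * cinner x (e n) = 0"
        by (simp add: power2_eq_square algebra_simps)
      moreover have "(s n)\<^sup>2 \<noteq> t\<^sup>2"
        using that assms s_nonneg[of n] by (auto simp: power2_eq_iff)
      ultimately have "cinner x (e n) = 0" by (simp flip: of_real_power)
      then show ?thesis by (simp add: cinner_diag_op_basis)
    qed
    have "(\<Sum>n | s n = t. scaleC (complex_of_real (s n) * cinner (diag_op e s x) (e n)) (e n))
        \<in> complex_vector.span ?B"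
      by (intro complex_vector.span_sum complex_vector.span_scale complex_vector.span_base) auto
    then have "diag_op e s (diag_op e s x) \<in> complex_vector.span ?B"
      using diag_op_finite_support[OF fin, of "diag_op e s x"] zero by simp
    then have "scaleC (inverse (complex_of_real (t\<^sup>2))) (scaleC (complex_of_real (t\<^sup>2)) x) \<in> complex_vector.span ?B"
      unfolding x by (rule complex_vector.span_scale)
    then show "x \<in> complex_vector.span ?B"
      using assms by (simp add: scaleC_scaleC scaleC_one)
  qed
qed

lemma card_eq_dim_eigenspace:
  assumes "t > 0"
  shows "card {n. s n = t} = complex_vector.dim (eigenspace (diag_op e s \<circ> diag_op e s) (t\<^sup>2))"
proof -
  have inj: "inj e"
  proof (rule injI)
    fix m n assume "e m = e n"
    then have "cinner (e m) (e n) = 1" using e by (simp add: orthonormal_seq_def)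
    then show "m = n" using e by (simp add: orthonormal_seq_def split: if_splits)
  qed
  have "complex_vector.independent (range e)"
  proof (subst complex_vector.dependent_explicit, safe)
    fix U u v assume U: "finite U" "U \<subseteq> range e" "(\<Sum>v\<in>U. scaleC (u v) v) = 0" "v \<in> U" "u v \<noteq> 0"
    have "cinner (\<Sum>w\<in>U. scaleC (u w) w) v = (\<Sum>w\<in>U. if w = v then u v else 0)"
      unfolding cinner_sum_left
    proof (rule sum.cong)
      fix w assume "w \<in> U"
      then obtain m n where "w = e m" "v = e n" using U by blast
      then show "cinner (scaleC (u w) w) v = (if w = v then u v else 0)"
        using e inj by (auto simp: cinner_scaleC_left orthonormal_seq_def inj_eq)
    qed simp
    then show False using U by simp
  qed
  then have "complex_vector.independent (e ` {n. s n = t})"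
    by (rule complex_vector.independent_mono) auto
  then have "complex_vector.dim (e ` {n. s n = t}) = card (e ` {n. s n = t})"
    by (rule complex_vector.dim_eq_card_independent)
  also have "\<dots> = card {n. s n = t}" using inj by (intro card_image) (auto intro: inj_on_subset)
  finally show ?thesis unfolding eigenspace_diag_op[OF assms] by simp
qed

text \<open>The image of the unit ball is within \<open>s N\<close> of a compact set for every \<open>N\<close>, hence totally
  bounded.\<close>

lemma diag_op_compact: "compact_op (diag_op e s)"
proof -
  let ?X = "diag_op e s ` cball 0 1"
  have tb: "\<exists>k. finite k \<and> closure ?X \<subseteq> (\<Union>x\<in>k. ball x r)" if "r > 0" for r
  proof -
    have "\<forall>\<^sub>F n in sequentially. s n < r / 4" using s_lim that by (intro order_tendstoD) auto
    then obtain N where N: "s N < r / 4" by (auto simp: eventually_sequentially)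
    obtain K where K: "compact K"
      "\<And>c. (\<forall>n<N. cmod (c n) \<le> s 0) \<Longrightarrow> (\<Sum>n<N. scaleC (c n) (e n)) \<in> K"
      using compact_bounded_combinations[where N = N and b = "s 0" and e = e] by blast
    then obtain k where k: "finite k" "K \<subseteq> (\<Union>x\<in>k. ball x (r / 4))"
      using compact_eq_totally_bounded[of K] \<open>r > 0\<close> by (meson zero_less_divide_iff zero_less_numeral)
    have "?X \<subseteq> (\<Union>x\<in>k. cball x (r / 2))"
    proof
      fix y assume "y \<in> ?X"
      then obtain x where x: "norm x \<le> 1" "y = diag_op e s x" by auto
      let ?p = "\<Sum>n<N. scaleC (complex_of_real (s n) * cinner x (e n)) (e n)"
      have "cmod (cinner x (e n)) \<le> 1" for n
        using cauchy_schwarz[of x "e n"] x(1) by (simp add: norm_orthonormal[OF e])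
      then have "cmod (complex_of_real (s n) * cinner x (e n)) \<le> s 0" for n
        using mult_mono[of "s n" "s 0" "cmod (cinner x (e n))" 1] s_nonneg s_dec[of 0 n]
        by (simp add: norm_mult)
      then have "?p \<in> K" by (intro K(2)) blast
      then obtain a where a: "a \<in> k" "dist a ?p < r / 4" using k(2) by (auto simp: dist_commute)
      have "dist ?p y \<le> s N * norm x"
        using diag_op_tail[of x N] by (simp add: x(2) dist_norm norm_minus_commute)
      also have "\<dots> \<le> s N" using x(1) s_nonneg[of N] by (simp add: mult_left_le)
      finally have "dist a y \<le> r / 2" using a(2) N dist_triangle[of a y ?p] by linarith
      then show "y \<in> (\<Union>x\<in>k. cball x (r / 2))" using a(1) by auto
    qed
    moreover have "closed (\<Union>x\<in>k. cball x (r / 2))" using k(1) by (intro closed_UN) auto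
    ultimately have "closure ?X \<subseteq> (\<Union>x\<in>k. cball x (r / 2))" by (rule closure_minimal)
    also have "\<dots> \<subseteq> (\<Union>x\<in>k. ball x r)" using that by (intro UN_mono) auto
    finally show ?thesis using k(1) by blast
  qed
  have "compact (closure ?X)"
    unfolding compact_eq_totally_bounded using tb by (simp add: complete_eq_closed)
  then show ?thesis by (simp add: compact_op_def diag_op_bounded)
qed

lemma is_s_numbers_diag_op: "is_s_numbers (diag_op e s) s"
  unfolding is_s_numbers_def
  using diag_op_compact s diag_op_self_adjoint card_eq_dim_eigenspace by blast

end

section \<open>Uniqueness of singular numbers\<close>

lemma is_adjoint_unique: "is_adjoint X Y \<Longrightarrow> is_adjoint X Z \<Longrightarrow> Y = Z"
  by (rule ext, rule cinner_eqI) (simp add: is_adjoint_def)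

text \<open>If \<open>s' n < s n\<close> at the first difference, then \<open>s'\<close> can no longer attain the value \<open>s n\<close> from \<open>n\<close> on,
  whereas \<open>s\<close> attains it once more; so the multiplicities of \<open>s n\<close> differ.\<close>

lemma c0_star_not_less_at_first_difference:
  assumes s: "s \<in> c0_star" and s': "s' \<in> c0_star"
    and card: "\<And>t. t > 0 \<Longrightarrow> card {n. s n = t} = card {n. s' n = t}"
    and agree: "\<And>i. i < n \<Longrightarrow> s i = s' i"
  shows "\<not> s' n < s n"
proof
  assume less: "s' n < s n"
  have "0 \<le> s' n" using s' by (simp add: c0_star_def)
  then have "s n > 0" using less by linarith
  have "{i. s' i = s n} \<subset> {i. s i = s n}"
  proof
    show "{i. s' i = s n} \<subseteq> {i. s i = s n}"
    proof safe
      fix i assume i: "s' i = s n"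
      have "i < n"
      proof (rule ccontr)
        assume "\<not> i < n"
        then have "s' i \<le> s' n" using s' by (simp add: c0_star_def decseq_def)
        with i less show False by simp
      qed
      then show "s i = s n" using agree i by simp
    qed
    have "n \<in> {i. s i = s n}" "n \<notin> {i. s' i = s n}" using less by auto
    then show "{i. s' i = s n} \<noteq> {i. s i = s n}" by blast
  qed
  then have "card {i. s' i = s n} < card {i. s i = s n}"
    using finite_level_set_c0_star[OF s \<open>s n > 0\<close>] by (rule psubset_card_mono[rotated])
  then show False using card[OF \<open>s n > 0\<close>] by simp
qed

lemma is_s_numbers_unique:
  assumes "is_s_numbers X s" "is_s_numbers X s'"
  shows "s = s'"
proof
  have c0: "s \<in> c0_star" "s' \<in> c0_star"
    and card: "card {n. s n = t} = card {n. s' n = t}" if "t > 0" for t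
    using assms that is_adjoint_unique unfolding is_s_numbers_def by (blast, blast, metis)
  show "s n = s' n" for n
  proof (induction n rule: less_induct)
    case (less n)
    have "\<not> s' n < s n" "\<not> s n < s' n"
      using c0_star_not_less_at_first_difference[of s s' n]
        c0_star_not_less_at_first_difference[of s' s n] c0[of 1] card less by simp_all
    then show ?case by simp
  qed
qed

text \<open>The part of Calkin's correspondence that turns equations between arithmetic mean ideals into
  equations between sets of sequences: uniqueness of singular numbers gives one inclusion, diagonal
  operators give the other.\<close>

lemma char_set_ideal_of:
  assumes "separable_infinite_dimensional TYPE('h::complex_hilbert)" and "S \<subseteq> c0_star"
  shows "char_set (ideal_of S :: ('h \<Rightarrow> 'h) set) = S"
proof
  show "char_set (ideal_of S :: ('h \<Rightarrow> 'h) set) \<subseteq> S"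
    by (auto simp: char_set_def ideal_of_def dest: is_s_numbers_unique)
  obtain e :: "nat \<Rightarrow> 'h" where "orthonormal_seq e"
    using assms(1) exists_orthonormal_seq unfolding separable_infinite_dimensional_def by blast
  then show "S \<subseteq> char_set (ideal_of S :: ('h \<Rightarrow> 'h) set)"
    using is_s_numbers_diag_op assms(2) unfolding char_set_def ideal_of_def by blast
qed

lemma char_set_subset_c0_star: "char_set I \<subseteq> c0_star"
  by (auto simp: char_set_def is_s_numbers_def)

section \<open>Arithmetic means\<close>

lemma sum_eq_amean: "(\<Sum>j\<le>n. \<xi> j) = real (n + 1) * amean \<xi> n"
  by (simp add: amean_def)

lemma amean_nonneg: "(\<And>j. 0 \<le> \<xi> j) \<Longrightarrow> 0 \<le> amean \<xi> n"
  by (simp add: amean_def sum_nonneg)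

lemma amean_0 [simp]: "amean \<xi> 0 = \<xi> 0"
  by (simp add: amean_def)

lemma sum_atMost_mono:
  fixes \<xi> :: "nat \<Rightarrow> real"
  assumes "\<And>j. 0 \<le> \<xi> j" "m \<le> n"
  shows "(\<Sum>j\<le>m. \<xi> j) \<le> (\<Sum>j\<le>n. \<xi> j)"
  using assms by (intro sum_mono2) auto

lemma sum_atMost_split:
  fixes \<xi> :: "nat \<Rightarrow> real"
  assumes "m \<le> n"
  shows "(\<Sum>j\<le>n. \<xi> j) = (\<Sum>j\<le>m. \<xi> j) + (\<Sum>j\<in>{m<..n}. \<xi> j)"
proof -
  have "{..n} = {..m} \<union> {m<..n}" "{..m} \<inter> {m<..n} = {}" using assms by auto
  then show ?thesis using sum.union_disjoint[of "{..m}" "{m<..n}" \<xi>] by simp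
qed

lemma sum_le_initial_plus:
  assumes "\<xi> \<in> c0_star"
  shows "(\<Sum>j\<le>k. \<xi> j) \<le> (\<Sum>j<n. \<xi> j) + real (k + 1) * \<xi> n"
proof -
  have "(\<Sum>j\<le>k. \<xi> j) \<le> (\<Sum>j\<le>k. (if j < n then \<xi> j else 0) + \<xi> n)"
    by (intro sum_mono) (auto intro: c0_starD[OF assms])
  also have "\<dots> = (\<Sum>j\<in>{..k} \<inter> {..<n}. \<xi> j) + real (k + 1) * \<xi> n"
    by (simp add: sum.distrib sum.inter_restrict)
  also have "\<dots> \<le> (\<Sum>j<n. \<xi> j) + real (k + 1) * \<xi> n"
    by (intro add_right_mono sum_mono2) (auto intro: c0_starD[OF assms])
  finally show ?thesis .
qed

lemma sum_le_card_head_plus: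
  assumes "\<xi> \<in> c0_star"
  shows "(\<Sum>j\<le>k. \<xi> j) \<le> real n * \<xi> 0 + real (k + 1) * \<xi> n"
proof -
  have "(\<Sum>j<n. \<xi> j) \<le> (\<Sum>j<n. \<xi> 0)"
    by (intro sum_mono c0_star_antimono[OF assms]) auto
  then show ?thesis using sum_le_initial_plus[OF assms, of k n] by simp
qed

lemma le_amean:
  assumes "\<xi> \<in> c0_star"
  shows "\<xi> n \<le> amean \<xi> n"
proof -
  have "(\<Sum>j\<le>n. \<xi> n) \<le> (\<Sum>j\<le>n. \<xi> j)"
    by (intro sum_mono c0_star_antimono[OF assms]) auto
  then show ?thesis by (simp add: amean_def field_simps)
qed

text \<open>The mean decreases because the next entry is at most the current mean; it tends to 0 because a
  fixed initial segment contributes only \<open>O(1/n)\<close>.\<close>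

lemma amean_in_c0_star:
  assumes "\<xi> \<in> c0_star"
  shows "amean \<xi> \<in> c0_star"
proof -
  have nonneg: "0 \<le> amean \<xi> n" for n
    by (intro amean_nonneg c0_star_nonneg[OF assms])
  have "amean \<xi> (Suc n) \<le> amean \<xi> n" for n
  proof -
    have "real (n + 2) * amean \<xi> (Suc n) = real (n + 1) * amean \<xi> n + \<xi> (Suc n)"
      using sum_eq_amean[of \<xi> n] sum_eq_amean[of \<xi> "Suc n"] by simp
    also have "\<dots> \<le> real (n + 1) * amean \<xi> n + amean \<xi> n"
      using le_amean[OF assms, of n] c0_star_antimono[OF assms, of n "Suc n"] by simp
    also have "\<dots> = real (n + 2) * amean \<xi> n" by (simp add: algebra_simps)
    finally show ?thesis by (rule mult_left_le_imp_le) simp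
  qed
  then have "decseq (amean \<xi>)" by (rule decseq_SucI)
  moreover have "amean \<xi> \<longlonglongrightarrow> 0"
  proof (rule LIMSEQ_I)
    fix r :: real assume "0 < r"
    then have "\<forall>\<^sub>F n in sequentially. \<xi> n < r / 2"
      by (intro order_tendstoD[OF c0_star_tendsto[OF assms]]) simp
    then obtain N where N: "\<xi> N < r / 2" by (auto simp: eventually_sequentially)
    obtain M :: nat where M: "2 * real N * \<xi> 0 / r < real M" using reals_Archimedean2 by blast
    have "amean \<xi> n < r" if "n \<ge> M" for n
    proof -
      have "real N * \<xi> 0 < real M * (r / 2)" using M \<open>0 < r\<close> by (simp add: field_simps)
      also have "\<dots> \<le> real (n + 1) * (r / 2)" using that \<open>0 < r\<close> by (intro mult_right_mono) auto
      finally have "real (n + 1) * amean \<xi> n < real (n + 1) * (r / 2) + real (n + 1) * \<xi> N"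
        using sum_le_card_head_plus[OF assms, of n N] by (simp add: sum_eq_amean)
      also have "\<dots> \<le> real (n + 1) * (r / 2) + real (n + 1) * (r / 2)"
        using N by (intro add_left_mono mult_left_mono) auto
      also have "\<dots> = real (n + 1) * r" by (simp add: algebra_simps)
      finally show ?thesis by (rule mult_left_less_imp_less) simp
    qed
    then show "\<exists>no. \<forall>n\<ge>no. norm (amean \<xi> n - 0) < r" using nonneg by auto
  qed
  ultimately show ?thesis using nonneg by (simp add: c0_star_def)
qed

lemma seq_bigoE:
  assumes "seq_bigo \<xi> \<eta>" "\<eta> \<in> c0_star"
  obtains C where "C > 0" "\<And>n. \<xi> n \<le> C * \<eta> n"
proof -
  obtain C where C: "\<And>n. \<xi> n \<le> C * \<eta> n" using assms(1) by (auto simp: seq_bigo_def)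
  have "\<xi> n \<le> max C 1 * \<eta> n" for n
    using C[of n] mult_right_mono[of C "max C 1" "\<eta> n"] c0_star_nonneg[OF assms(2), of n] by simp
  then show ?thesis by (rule that[rotated]) simp
qed

lemma seq_bigo_trans:
  assumes "seq_bigo \<xi> \<eta>" "seq_bigo \<eta> \<zeta>" "\<eta> \<in> c0_star"
  shows "seq_bigo \<xi> \<zeta>"
proof -
  obtain C where C: "C > 0" "\<And>n. \<xi> n \<le> C * \<eta> n" using seq_bigoE assms(1,3) by blast
  obtain D where D: "\<And>n. \<eta> n \<le> D * \<zeta> n" using assms(2) by (auto simp: seq_bigo_def)
  have "\<xi> n \<le> (C * D) * \<zeta> n" for n
    using order_trans[OF C(2)[of n] mult_left_mono[OF D[of n]]] C(1) by (simp add: mult.assoc)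
  then show ?thesis unfolding seq_bigo_def by blast
qed

lemma seq_bigo_of_le: "(\<And>n. \<xi> n \<le> \<eta> n) \<Longrightarrow> seq_bigo \<xi> \<eta>"
  unfolding seq_bigo_def by (intro exI[of _ 1]) simp

lemma seq_bigo_amean:
  assumes "seq_bigo \<xi> \<eta>"
  shows "seq_bigo (amean \<xi>) (amean \<eta>)"
proof -
  obtain C where C: "\<And>n. \<xi> n \<le> C * \<eta> n" using assms by (auto simp: seq_bigo_def)
  have "amean \<xi> n \<le> C * amean \<eta> n" for n
  proof -
    have "(\<Sum>j\<le>n. \<xi> j) \<le> C * (\<Sum>j\<le>n. \<eta> j)"
      unfolding sum_distrib_left by (intro sum_mono C)
    then show ?thesis by (simp add: amean_def divide_right_mono)
  qed
  then show ?thesis unfolding seq_bigo_def by blast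
qed

lemma ampliation_in_c0_star:
  assumes "\<eta> \<in> c0_star" "m \<ge> 1"
  shows "ampliation m \<eta> \<in> c0_star"
proof -
  have "decseq (ampliation m \<eta>)"
    by (auto simp: decseq_def ampliation_def intro!: c0_star_antimono[OF assms(1)] div_le_mono)
  moreover have "(\<lambda>n. \<eta> (n div m)) \<longlonglongrightarrow> 0"
    by (rule filterlim_compose[OF c0_star_tendsto[OF assms(1)] filterlim_at_top_div_const_nat])
      (use assms(2) in simp)
  ultimately show ?thesis
    using c0_star_nonneg[OF assms(1)] by (simp add: c0_star_def ampliation_def[abs_def])
qed

text \<open>Each entry of \<open>\<eta>\<close> occurs at most \<open>m\<close> times in an initial segment of the ampliation. So ampliations
  do not enlarge the arithmetic mean of a principal ideal.\<close>

lemma amean_ampliation_bigo: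
  assumes "\<eta> \<in> c0_star" "m \<ge> 1"
  shows "seq_bigo (amean (ampliation m \<eta>)) (amean \<eta>)"
proof -
  have "amean (ampliation m \<eta>) n \<le> real m * amean \<eta> n" for n
  proof -
    have card: "card {j \<in> {..n}. j div m = i} \<le> m" for i
    proof -
      have "{j \<in> {..n}. j div m = i} \<subseteq> {i * m..<i * m + m}"
        using assms(2) dividend_less_div_times[of m] by (auto simp: add.commute)
      then show ?thesis using card_mono[of "{i * m..<i * m + m}"] by fastforce
    qed
    have "(\<Sum>j\<le>n. \<eta> (j div m)) = (\<Sum>i\<le>n. \<Sum>j\<in>{j \<in> {..n}. j div m = i}. \<eta> (j div m))"
      by (rule sum.group[symmetric]) (auto intro: order_trans[OF div_le_dividend])
    also have "\<dots> = (\<Sum>i\<le>n. real (card {j \<in> {..n}. j div m = i}) * \<eta> i)"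
      by (rule sum.cong) auto
    also have "\<dots> \<le> (\<Sum>i\<le>n. real m * \<eta> i)"
      using card by (intro sum_mono mult_right_mono) (auto intro: c0_star_nonneg[OF assms(1)])
    finally show ?thesis
      by (simp add: amean_def ampliation_def divide_right_mono flip: sum_distrib_left)
  qed
  then show ?thesis unfolding seq_bigo_def by blast
qed

section \<open>Second order means and harmonic numbers\<close>

lemma sum_inverse_eq_harm_diff:
  assumes "m \<le> n"
  shows "(\<Sum>j\<in>{m<..n}. 1 / real (j + 1)) = harm (Suc n) - (harm (Suc m) :: real)"
  using assms
proof (induction n rule: dec_induct)
  case (step n)
  have "{m<..Suc n} = insert (Suc n) {m<..n}" using step.hyps by auto
  then show ?case using step.IH harm_Suc[of "Suc n", where 'a = real] by (simp add: inverse_eq_divide)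
qed simp

text \<open>With its companion below: the numerator of \<open>amean \<xi> j\<close>, a partial sum of \<open>\<xi>\<close>, increases with
  \<open>j\<close>, and the denominators add up to a difference of harmonic numbers.\<close>

lemma sum_amean_tail_le:
  assumes "\<And>j. 0 \<le> \<xi> j" "m \<le> n"
  shows "(\<Sum>j\<in>{m<..n}. amean \<xi> j) \<le> (\<Sum>j\<le>n. \<xi> j) * (harm (Suc n) - harm (Suc m))"
  unfolding sum_inverse_eq_harm_diff[OF assms(2), symmetric] sum_distrib_left
  by (intro sum_mono) (auto simp: amean_def intro!: divide_right_mono sum_atMost_mono assms)

lemma sum_amean_tail_ge:
  assumes "\<And>j. 0 \<le> \<xi> j" "m \<le> n"
  shows "(\<Sum>j\<le>m. \<xi> j) * (harm (Suc n) - harm (Suc m)) \<le> (\<Sum>j\<in>{m<..n}. amean \<xi> j)"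
  unfolding sum_inverse_eq_harm_diff[OF assms(2), symmetric] sum_distrib_left
  by (intro sum_mono) (auto simp: amean_def intro!: divide_right_mono sum_atMost_mono assms)

lemma sum_amean_le:
  assumes "\<And>j. 0 \<le> \<xi> j"
  shows "(\<Sum>j\<le>n. amean \<xi> j) \<le> (\<Sum>j\<le>n. \<xi> j) * harm (Suc n)"
proof -
  have "(\<Sum>j\<le>n. amean \<xi> j) = \<xi> 0 + (\<Sum>j\<in>{0<..n}. amean \<xi> j)"
    using sum_atMost_split[of 0 n "amean \<xi>"] by simp
  also have "\<dots> \<le> (\<Sum>j\<le>n. \<xi> j) + (\<Sum>j\<le>n. \<xi> j) * (harm (Suc n) - harm (Suc 0))"
    using sum_atMost_mono[of \<xi> 0 n] sum_amean_tail_le[of \<xi> 0 n] assms by (intro add_mono) auto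
  finally show ?thesis by (simp add: harm_expand algebra_simps)
qed

lemma harm_eventually_ge: "\<exists>N. \<forall>n\<ge>N. (harm (Suc n) :: real) \<ge> c"
proof -
  have "\<forall>\<^sub>F n in sequentially. (harm n :: real) \<ge> c"
    using harm_at_top by (auto simp: filterlim_at_top)
  then obtain N where "\<And>n. n \<ge> N \<Longrightarrow> (harm n :: real) \<ge> c"
    by (auto simp: eventually_sequentially)
  then show ?thesis by (intro exI[of _ N]) auto
qed

section \<open>Ratio of regularity equivalent to the logarithm\<close>

text \<open>The lower half of \<open>r(\<eta>\<^sub>a) \<asymp> log\<close>, with harmonic numbers in place of the logarithm so that index
  0 is covered too.\<close>

lemma ratio_equiv_log_harm:
  assumes "\<eta> \<in> c0_star" "ratio_equiv_log \<eta>"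
  obtains a where "0 < a" "a \<le> 1" "\<eta> 0 > 0"
    "\<And>n. a * harm (Suc n) * amean \<eta> n \<le> amean (amean \<eta>) n"
proof -
  obtain \<alpha> where \<alpha>: "\<alpha> > 0"
    "\<And>n. n \<ge> 1 \<Longrightarrow> \<alpha> * ln (real (n + 1)) \<le> amean (amean \<eta>) n / amean \<eta> n"
    using assms(2) unfolding ratio_equiv_log_def regularity_ratio_def by blast
  have pos0: "\<eta> 0 > 0"
  proof (rule ccontr)
    assume "\<not> \<eta> 0 > 0"
    then have "\<eta> n = 0" for n
      using c0_star_nonneg[OF assms(1), of n] c0_star_antimono[OF assms(1), of 0 n] by simp
    then show False using assms(2) by (auto simp: ratio_equiv_log_def)
  qed
  have pos: "amean \<eta> n > 0" for n
  proof -
    have "0 < (\<Sum>j\<le>n. \<eta> j)"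
      using pos0 sum_atMost_mono[of \<eta> 0 n] c0_star_nonneg[OF assms(1)] by simp
    then show ?thesis by (simp add: amean_def)
  qed
  define a where "a = min 1 (\<alpha> / 3)"
  have "a * harm (Suc n) * amean \<eta> n \<le> amean (amean \<eta>) n" for n
  proof (cases "n = 0")
    case True
    then show ?thesis using pos0 by (simp add: harm_expand a_def mult_right_le_one_le)
  next
    case False
    have "harm (Suc n) - ln (real (Suc n)) \<le> (1 :: real)"
      using decseqD[OF decseq_harm_diff_ln, of 0 n] by (simp add: harm_expand)
    moreover have "1 \<le> 2 * ln (real (Suc n))"
    proof -
      have "ln 2 \<le> ln (real (Suc n))" using False by (subst ln_le_cancel_iff) auto
      then show ?thesis using ln2_ge_two_thirds by linarith
    qed
    ultimately have "harm (Suc n) \<le> 3 * ln (real (n + 1))" by simp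
    then have "a * harm (Suc n) \<le> \<alpha> / 3 * (3 * ln (real (n + 1)))"
      using \<alpha>(1) by (intro mult_mono) (auto simp: a_def harm_nonneg)
    also have "\<dots> \<le> amean (amean \<eta>) n / amean \<eta> n" using \<alpha>(2)[of n] False by simp
    finally show ?thesis using pos[of n] by (simp add: field_simps)
  qed
  then show ?thesis using \<alpha>(1) pos0 by (intro that[of a]) (auto simp: a_def)
qed

text \<open>Let \<open>m\<close> be the least index whose harmonic distance \<open>D = h m - h n\<close> from \<open>n\<close> reaches \<open>a/4\<close> times
  \<open>h m\<close>; for large \<open>n\<close> it does not exceed \<open>a/2\<close> times \<open>h m\<close>. Write \<open>P\<close>, \<open>Q\<close>, \<open>L \<xi>\<close>
  for the partial sums of \<open>\<zeta>\<close>, \<open>\<eta>\<close>, \<open>amean \<xi>\<close>. Then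
  \<open>P n * D \<le> L \<zeta> m \<le> C * L \<eta> m \<le> C * (Q n * h m + Q m * D)\<close>. The lower bound
  \<open>a * h m * Q m \<le> L \<eta> m\<close> lets the term \<open>Q m * D\<close> be absorbed into \<open>Q n * h m\<close>, because \<open>D\<close> takes at
  most half of \<open>a * h m\<close>. Dividing by \<open>h m\<close> compares \<open>P n\<close> with \<open>Q n\<close>.\<close>

lemma amean_le_of_second_mean_le_log:
  assumes \<eta>: "\<eta> \<in> c0_star" "ratio_equiv_log \<eta>" and \<zeta>: "\<zeta> \<in> c0_star"
    and le: "seq_bigo (amean (amean \<zeta>)) (amean (amean \<eta>))"
  shows "seq_bigo (amean \<zeta>) (amean \<eta>)"
proof -
  obtain a where a: "0 < a" "a \<le> 1" and \<eta>0: "\<eta> 0 > 0"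
    and log: "\<And>n. a * harm (Suc n) * amean \<eta> n \<le> amean (amean \<eta>) n"
    using ratio_equiv_log_harm \<eta> by blast
  obtain C where C: "C > 0" "\<And>n. amean (amean \<zeta>) n \<le> C * amean (amean \<eta>) n"
    using seq_bigoE[OF le] amean_in_c0_star \<eta>(1) by blast
  define P where "P n = (\<Sum>j\<le>n. \<zeta> j)" for n
  define Q where "Q n = (\<Sum>j\<le>n. \<eta> j)" for n
  define L where "L \<xi> n = (\<Sum>j\<le>n. amean \<xi> j)" for \<xi> n
  let ?h = "\<lambda>n. harm (Suc n) :: real"
  note nn = c0_star_nonneg[OF \<eta>(1)] c0_star_nonneg[OF \<zeta>]
  have Q_ge: "\<eta> 0 \<le> Q n" for n using sum_atMost_mono[of \<eta> 0 n] nn by (simp add: Q_def)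
  have L_le: "L \<zeta> n \<le> C * L \<eta> n" for n
    using mult_left_mono[OF C(2)[of n], of "real (n + 1)"]
    by (simp add: L_def sum_eq_amean mult.left_commute)
  have Q_log: "a * ?h n * Q n \<le> L \<eta> n" for n
    using mult_left_mono[OF log[of n], of "real (n + 1)"]
    by (simp add: L_def Q_def sum_eq_amean mult.left_commute)
  obtain N :: nat where N: "4 / a < real N" using reals_Archimedean2 by blast
  have large: "P n \<le> 8 * C / a * Q n" if "n \<ge> N" for n
  proof -
    define good where "good m \<longleftrightarrow> n \<le> m \<and> a / 4 * ?h m \<le> ?h m - ?h n" for m
    have "\<exists>m. good m"
    proof -
      obtain M where "\<And>m. m \<ge> M \<Longrightarrow> ?h m \<ge> 2 * ?h n" using harm_eventually_ge by blast
      then have "2 * ?h n \<le> ?h (max M n)" by simp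
      moreover have "a / 4 * ?h (max M n) \<le> 1 / 2 * ?h (max M n)"
        using a by (intro mult_right_mono) (auto simp: harm_nonneg)
      ultimately have "a / 4 * ?h (max M n) \<le> ?h (max M n) - ?h n" by linarith
      then have "good (max M n)" unfolding good_def by simp
      then show ?thesis ..
    qed
    then obtain m where m: "good m" and least: "\<And>k. k < m \<Longrightarrow> \<not> good k"
      using exists_least_iff[of good] by blast
    have "n < m"
    proof -
      have "n \<noteq> m"
      proof
        assume "n = m"
        then have "a / 4 * ?h m \<le> 0" using m by (simp add: good_def)
        moreover have "a / 4 * ?h m > 0" using a by simp
        ultimately show False by linarith
      qed
      then show ?thesis using m by (simp add: good_def)
    qed
    then obtain k where k: "m = Suc k" "n \<le> k" by (cases m) auto
    have hm: "1 \<le> ?h m" using harm_mono[of 1 "Suc m", where 'a = real] by (simp add: harm_expand)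
    have D_ge: "a / 4 * ?h m \<le> ?h m - ?h n" using m by (simp add: good_def)
    have D_le: "?h m - ?h n \<le> a / 2 * ?h m"
    proof -
      have "?h k - ?h n \<le> a / 4 * ?h k" using least[of k] k by (simp add: good_def)
      also have "\<dots> \<le> a / 4 * ?h m" using a k by (intro mult_left_mono harm_mono) auto
      finally have "?h m - ?h n \<le> a / 4 * ?h m + inverse (real (Suc m))"
        using k(1) harm_Suc[of "Suc k", where 'a = real] by simp
      moreover have "inverse (real (Suc m)) \<le> a / 4 * ?h m"
      proof -
        have "4 / a \<le> real (Suc m)" using N that \<open>n < m\<close> by linarith
        then have "inverse (real (Suc m)) \<le> inverse (4 / a)"
          using a by (intro le_imp_inverse_le) auto
        also have "\<dots> \<le> a / 4 * ?h m" using hm a by (simp add: field_simps)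
        finally show ?thesis .
      qed
      ultimately show ?thesis by simp
    qed
    have D_nonneg: "0 \<le> ?h m - ?h n" using harm_mono[of "Suc n" "Suc m", where 'a = real] \<open>n < m\<close> by simp
    have L\<eta>: "L \<eta> m \<le> Q n * ?h m + Q m * (?h m - ?h n)"
    proof -
      have "L \<eta> n \<le> Q n * ?h n" unfolding L_def Q_def by (rule sum_amean_le) (rule nn)
      also have "\<dots> \<le> Q n * ?h m"
        using Q_ge[of n] \<eta>0 D_nonneg by (intro mult_left_mono) auto
      finally show ?thesis
        using sum_amean_tail_le[of \<eta> n m] sum_atMost_split[of n m "amean \<eta>"] nn \<open>n < m\<close>
        by (simp add: L_def Q_def)
    qed
    have "Q m * (?h m - ?h n) \<le> Q m * (a / 2 * ?h m)"
      using D_le Q_ge[of m] \<eta>0 by (intro mult_left_mono) auto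
    moreover have "a * ?h m * Q m = 2 * (Q m * (a / 2 * ?h m))" by simp
    ultimately have Qm: "Q m * (?h m - ?h n) \<le> Q n * ?h m"
      using L\<eta> Q_log[of m] by linarith
    have "P n * (a / 4 * ?h m) \<le> P n * (?h m - ?h n)"
      using D_ge nn by (intro mult_left_mono) (auto simp: P_def sum_nonneg)
    also have "\<dots> \<le> L \<zeta> m"
    proof -
      have "P n * (?h m - ?h n) \<le> (\<Sum>j\<in>{n<..m}. amean \<zeta> j)"
        unfolding P_def using \<open>n < m\<close> nn by (intro sum_amean_tail_ge) auto
      also have "\<dots> \<le> L \<zeta> m"
        unfolding L_def using nn by (intro sum_mono2) (auto intro: amean_nonneg)
      finally show ?thesis .
    qed
    also have "\<dots> \<le> C * L \<eta> m" by (rule L_le)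
    also have "\<dots> \<le> C * (2 * (Q n * ?h m))"
      using L\<eta> Qm C(1) by (intro mult_left_mono) auto
    finally have "P n * (a / 4) * ?h m \<le> C * 2 * Q n * ?h m" by (simp add: algebra_simps)
    then have "P n * (a / 4) \<le> C * 2 * Q n" using hm by (simp add: mult_le_cancel_right)
    then show ?thesis using a by (simp add: field_simps)
  qed
  \<comment> \<open>The finitely many \<open>n < N\<close> are absorbed in the constant, as \<open>Q n \<ge> \<eta> 0 > 0\<close>.\<close>
  have "P n \<le> (8 * C / a + P N / \<eta> 0) * Q n" for n
  proof (cases "n \<ge> N")
    case True
    have "0 \<le> P N / \<eta> 0 * Q n"
      using Q_ge[of n] \<eta>0 nn by (simp add: P_def sum_nonneg)
    then show ?thesis using large[OF True] by (simp add: algebra_simps)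
  next
    case False
    have "P n \<le> P N" unfolding P_def using False nn by (intro sum_atMost_mono) auto
    also have "\<dots> = P N / \<eta> 0 * \<eta> 0" using \<eta>0 by simp
    also have "\<dots> \<le> P N / \<eta> 0 * Q n"
      using Q_ge[of n] \<eta>0 nn by (intro mult_left_mono) (auto simp: P_def sum_nonneg)
    also have "\<dots> \<le> (8 * C / a + P N / \<eta> 0) * Q n"
      using Q_ge[of n] \<eta>0 a C(1) by (intro mult_right_mono) auto
    finally show ?thesis .
  qed
  then have "amean \<zeta> n \<le> (8 * C / a + P N / \<eta> 0) * amean \<eta> n" for n
    unfolding P_def Q_def amean_def by (simp add: divide_right_mono)
  then show ?thesis unfolding seq_bigo_def by blast
qed

text \<open>The second mean of any \<open>\<zeta>\<close> is at most \<open>harm\<close> times the first, whereas for \<open>\<eta>\<close> it is at least a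
  multiple of that; the harmonic factor cancels.\<close>

lemma amean_ge_of_second_mean_ge_log:
  assumes \<eta>: "\<eta> \<in> c0_star" "ratio_equiv_log \<eta>" and \<zeta>: "\<zeta> \<in> c0_star"
    and ge: "seq_bigo (amean (amean \<eta>)) (amean (amean \<zeta>))"
  shows "seq_bigo (amean \<eta>) (amean \<zeta>)"
proof -
  obtain a where a: "0 < a"
    and log: "\<And>n. a * harm (Suc n) * amean \<eta> n \<le> amean (amean \<eta>) n"
    using ratio_equiv_log_harm \<eta> by metis
  obtain C where C: "C > 0" "\<And>n. amean (amean \<eta>) n \<le> C * amean (amean \<zeta>) n"
    using seq_bigoE[OF ge] amean_in_c0_star \<zeta> by blast
  have "amean \<eta> n \<le> (C / a) * amean \<zeta> n" for n
  proof -
    have "amean (amean \<zeta>) n \<le> amean \<zeta> n * harm (Suc n)"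
      using sum_amean_le[of \<zeta> n] c0_star_nonneg[OF \<zeta>]
      by (simp add: sum_eq_amean mult.assoc)
    then have "a * harm (Suc n) * amean \<eta> n \<le> C * (amean \<zeta> n * harm (Suc n))"
      using log[of n] C(2)[of n] mult_left_mono[of "amean (amean \<zeta>) n" "amean \<zeta> n * harm (Suc n)" C] C(1)
      by linarith
    then have "(a * amean \<eta> n) * harm (Suc n) \<le> (C * amean \<zeta> n) * harm (Suc n)"
      by (simp add: algebra_simps)
    then have "a * amean \<eta> n \<le> C * amean \<zeta> n"
      by (rule mult_right_le_imp_le) simp
    then show ?thesis using a by (simp add: field_simps)
  qed
  then show ?thesis unfolding seq_bigo_def by blast
qed

section \<open>Regular sequences\<close>

lemma amean_le_of_second_mean_le_regular:
  assumes \<eta>: "\<eta> \<in> c0_star" "seq_bigo (amean \<eta>) \<eta>" and \<zeta>: "\<zeta> \<in> c0_star"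
    and le: "seq_bigo (amean (amean \<zeta>)) (amean (amean \<eta>))"
  shows "seq_bigo (amean \<zeta>) (amean \<eta>)"
proof -
  have "seq_bigo (amean \<zeta>) (amean (amean \<zeta>))"
    by (intro seq_bigo_of_le le_amean amean_in_c0_star \<zeta>)
  moreover have "seq_bigo (amean (amean \<zeta>)) (amean \<eta>)"
    using le seq_bigo_amean[OF \<eta>(2)] by (rule seq_bigo_trans) (intro amean_in_c0_star \<eta>)
  ultimately show ?thesis by (rule seq_bigo_trans) (intro amean_in_c0_star \<zeta>)
qed

text \<open>Let \<open>h\<close> be the harmonic numbers and \<open>P\<close>, \<open>L \<xi>\<close> the partial sums of \<open>\<zeta>\<close>, \<open>amean \<xi>\<close>. Regularity bounds \<open>L \<eta> j / (j + 1)\<close> by \<open>R * amean \<eta> j\<close>,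
  so \<open>L \<eta> n * (h m - h n) \<le> R * L \<eta> m\<close>: over a harmonic distance \<open>K\<close> the sum \<open>L \<eta>\<close> grows by the factor
  \<open>K / R\<close>. For large \<open>K\<close> the part of \<open>L \<zeta> m\<close> up to \<open>n\<close>, which is at most \<open>A * L \<eta> n\<close>, is then too
  small to account for half of \<open>L \<eta> m \<le> B * L \<zeta> m\<close>, and the part beyond \<open>n\<close> is at most
  \<open>P m * (K + 1)\<close>.\<close>

lemma amean_ge_of_second_mean_equiv_regular:
  assumes \<eta>: "\<eta> \<in> c0_star" "seq_bigo (amean \<eta>) \<eta>" and \<zeta>: "\<zeta> \<in> c0_star"
    and le: "seq_bigo (amean (amean \<zeta>)) (amean (amean \<eta>))"
    and ge: "seq_bigo (amean (amean \<eta>)) (amean (amean \<zeta>))"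
  shows "seq_bigo (amean \<eta>) (amean \<zeta>)"
proof -
  note nn = c0_star_nonneg[OF \<eta>(1)] c0_star_nonneg[OF \<zeta>]
  obtain A where A: "A > 0" "\<And>n. amean (amean \<zeta>) n \<le> A * amean (amean \<eta>) n"
    using seq_bigoE[OF le] amean_in_c0_star \<eta>(1) by blast
  obtain B where B: "B > 0" "\<And>n. amean (amean \<eta>) n \<le> B * amean (amean \<zeta>) n"
    using seq_bigoE[OF ge] amean_in_c0_star \<zeta> by blast
  obtain R where R: "R > 0" "\<And>n. amean (amean \<eta>) n \<le> R * amean \<eta> n"
    using seq_bigoE[OF seq_bigo_amean[OF \<eta>(2)]] amean_in_c0_star \<eta>(1) by blast
  define P where "P n = (\<Sum>j\<le>n. \<zeta> j)" for n
  define Q where "Q n = (\<Sum>j\<le>n. \<eta> j)" for n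
  define L where "L \<xi> n = (\<Sum>j\<le>n. amean \<xi> j)" for \<xi> n
  let ?h = "\<lambda>n. harm (Suc n) :: real"
  have L_le: "L \<zeta> n \<le> A * L \<eta> n" for n
    using mult_left_mono[OF A(2)[of n], of "real (n + 1)"]
    by (simp add: L_def sum_eq_amean mult.left_commute)
  have L_ge: "L \<eta> n \<le> B * L \<zeta> n" for n
    using mult_left_mono[OF B(2)[of n], of "real (n + 1)"]
    by (simp add: L_def sum_eq_amean mult.left_commute)
  have Q_le_L: "Q n \<le> L \<eta> n" for n
    unfolding Q_def L_def by (intro sum_mono le_amean \<eta>)
  have L_nonneg: "0 \<le> L \<xi> n" if "\<And>j. 0 \<le> \<xi> j" for \<xi> n
    unfolding L_def using that by (intro sum_nonneg amean_nonneg) auto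
  \<comment> \<open>A harmonic distance over which \<open>L \<eta>\<close> grows by the factor \<open>2 * A * B\<close>, halving the head.\<close>
  define K where "K = 2 * A * B * R"
  have K: "K > 0" using A B R by (simp add: K_def)
  show ?thesis
  proof (cases "\<zeta> 0 = 0")
    case True
    then have "\<eta> 0 \<le> 0" using B(2)[of 0] by simp
    then have "\<eta> n = 0" for n
      using c0_star_antimono[OF \<eta>(1), of 0 n] nn(1)[of n] by simp
    then have "amean \<eta> n \<le> 1 * amean \<zeta> n" for n
      using amean_nonneg[of \<zeta> n] nn(2) by (simp add: amean_def)
    then show ?thesis unfolding seq_bigo_def by blast
  next
    case False
    then have \<zeta>0: "\<zeta> 0 > 0" using nn(2)[of 0] by simp
    have P_ge: "\<zeta> 0 \<le> P n" for n using sum_atMost_mono[of \<zeta> 0 n] nn by (simp add: P_def)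
    \<comment> \<open>Beyond \<open>N\<close> index 0 is farther from \<open>m\<close> than \<open>K + 1\<close>, so the index \<open>n\<close> below is positive.\<close>
    obtain N where N: "\<And>m. m \<ge> N \<Longrightarrow> K + 3 \<le> ?h m" using harm_eventually_ge by blast
    have large: "Q m \<le> 2 * B * (K + 1) * P m" if "m \<ge> N" for m
    proof -
      define near where "near n \<longleftrightarrow> ?h m - ?h n \<le> K + 1" for n
      have "near m" using K by (simp add: near_def)
      then obtain n where n: "near n" and least: "\<And>k. k < n \<Longrightarrow> \<not> near k"
        using exists_least_iff[of near] by blast
      have "n \<le> m" using least[of m] \<open>near m\<close> by (meson not_le)
      have "n \<noteq> 0"
      proof
        assume "n = 0"
        then show False using n N[OF that] by (simp add: near_def harm_expand)
      qed
      then obtain k where k: "n = Suc k" by (cases n) auto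
      have D_le: "?h m - ?h n \<le> K + 1" using n by (simp add: near_def)
      \<comment> \<open>Consecutive harmonic numbers differ by at most 1, so stepping from \<open>n - 1\<close> cannot skip \<open>[K, K + 1]\<close>.\<close>
      have D_ge: "K \<le> ?h m - ?h n"
      proof -
        have "?h n = ?h k + inverse (real (Suc n))" using harm_Suc[of "Suc k", where 'a = real] k by simp
        moreover have "inverse (real (Suc n)) \<le> 1" by (simp add: inverse_le_1_iff)
        moreover have "?h m - ?h k > K + 1" using least[of k] k by (simp add: near_def)
        ultimately show ?thesis by linarith
      qed
      have "2 * A * B * R * L \<eta> n \<le> L \<eta> n * (?h m - ?h n)"
        using mult_left_mono[OF D_ge L_nonneg[of \<eta> n]] nn by (simp add: K_def mult.commute)
      also have "\<dots> \<le> (\<Sum>j\<in>{n<..m}. amean (amean \<eta>) j)"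
        unfolding L_def using nn \<open>n \<le> m\<close> by (intro sum_amean_tail_ge amean_nonneg) auto
      also have "\<dots> \<le> (\<Sum>j\<in>{n<..m}. R * amean \<eta> j)" by (intro sum_mono R)
      also have "\<dots> \<le> R * L \<eta> m"
        unfolding L_def sum_distrib_left[symmetric] using R nn
        by (intro mult_left_mono sum_mono2) (auto intro: amean_nonneg)
      finally have "R * (2 * (A * B * L \<eta> n)) \<le> R * L \<eta> m" by (simp add: algebra_simps)
      then have half: "2 * (A * B * L \<eta> n) \<le> L \<eta> m" using R(1) by (simp add: mult_le_cancel_left)
      have "L \<zeta> m \<le> L \<zeta> n + P m * (?h m - ?h n)"
        using sum_amean_tail_le[of \<zeta> n m] sum_atMost_split[of n m "amean \<zeta>"] nn \<open>n \<le> m\<close>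
        by (simp add: L_def P_def)
      also have "\<dots> \<le> A * L \<eta> n + P m * (K + 1)"
        using L_le[of n] D_le P_ge[of m] \<zeta>0 by (intro add_mono mult_left_mono) auto
      finally have "B * L \<zeta> m \<le> B * (A * L \<eta> n + P m * (K + 1))"
        using B(1) by (intro mult_left_mono) auto
      then have "L \<eta> m \<le> A * B * L \<eta> n + B * (K + 1) * P m"
        using L_ge[of m] by (simp add: algebra_simps)
      then have "L \<eta> m \<le> 2 * (B * (K + 1) * P m)" using half by linarith
      then show ?thesis using Q_le_L[of m] by simp
    qed
    have Q_nonneg: "0 \<le> Q n" for n unfolding Q_def using nn by (intro sum_nonneg) auto
    have "Q m \<le> (2 * B * (K + 1) + Q N / \<zeta> 0) * P m" for m
    proof (cases "m \<ge> N")
      case True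
      have "0 \<le> Q N / \<zeta> 0 * P m"
        using P_ge[of m] \<zeta>0 Q_nonneg[of N] by simp
      then show ?thesis using large[OF True] by (simp add: algebra_simps)
    next
      case False
      have "Q m \<le> Q N" unfolding Q_def using False nn by (intro sum_atMost_mono) auto
      also have "\<dots> = Q N / \<zeta> 0 * \<zeta> 0" using \<zeta>0 by simp
      also have "\<dots> \<le> Q N / \<zeta> 0 * P m"
        using P_ge[of m] \<zeta>0 Q_nonneg[of N] by (intro mult_left_mono) auto
      also have "\<dots> \<le> (2 * B * (K + 1) + Q N / \<zeta> 0) * P m"
        using P_ge[of m] \<zeta>0 K B(1) by (intro mult_right_mono) auto
      finally show ?thesis .
    qed
    then have "amean \<eta> n \<le> (2 * B * (K + 1) + Q N / \<zeta> 0) * amean \<zeta> n" for n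
      unfolding P_def Q_def amean_def by (simp add: divide_right_mono)
    then show ?thesis unfolding seq_bigo_def by blast
  qed
qed

section \<open>Sequences equivalent to their hat\<close>

lemma sum_hat_index_ge:
  assumes "\<eta> \<in> c0_star" "\<not> summable \<eta>"
  shows "real (n + 1) * \<eta> 0 \<le> (\<Sum>i\<le>hat_index \<eta> n. \<eta> i)"
proof -
  have "\<exists>k. real (n + 1) * \<eta> 0 \<le> (\<Sum>i\<le>k. \<eta> i)"
  proof (rule ccontr)
    assume "\<not> ?thesis"
    then have *: "(\<Sum>i\<le>k. \<eta> i) \<le> real (n + 1) * \<eta> 0" for k
      by (meson linear)
    have "(\<Sum>i<k. \<eta> i) \<le> (\<Sum>i\<le>k. \<eta> i)" for k
      using c0_star_nonneg[OF assms(1)] by (intro sum_mono2) auto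
    then have "(\<Sum>i<k. \<eta> i) \<le> real (n + 1) * \<eta> 0" for k
      using * order_trans by blast
    then have "summable \<eta>"
      by (intro summableI_nonneg_bounded[where x = "real (n + 1) * \<eta> 0"] c0_star_nonneg[OF assms(1)])
    then show False using assms(2) by simp
  qed
  then show ?thesis unfolding hat_index_def by (rule LeastI_ex)
qed

lemma pos_of_not_summable:
  assumes "\<eta> \<in> c0_star" "\<not> summable \<eta>"
  shows "\<eta> n > 0"
proof (rule ccontr)
  assume "\<not> \<eta> n > 0"
  then have "\<eta> i = 0" if "i \<ge> n" for i
    using c0_star_antimono[OF assms(1) that] c0_star_nonneg[OF assms(1), of i] by simp
  then have "summable \<eta>" by (intro summable_finite[of "{..<n}"]) (auto simp: not_less)
  then show False using assms(2) by simp
qed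

text \<open>With \<open>k = hat_index \<eta> m\<close>, the first \<open>n\<close> terms account for at most half of the sum up to \<open>k\<close>. The
  other half consists of terms bounded by \<open>\<eta> n\<close>, hence \<open>hat \<eta> m\<close>, the mean over this sum, is at most
  \<open>2 * \<eta> n\<close>. The point is that the factor is independent of how far \<open>m\<close> lies before \<open>n\<close>.\<close>

lemma le_of_bigo_hat:
  assumes \<eta>: "\<eta> \<in> c0_star" "\<not> summable \<eta>"
    and b: "b > 0" "\<And>n. \<eta> n \<le> b * hat \<eta> n"
    and small: "2 * (\<Sum>i\<le>n. \<eta> i) \<le> real (m + 1) * \<eta> 0"
  shows "\<eta> m \<le> 2 * b * \<eta> n"
proof -
  define k where "k = hat_index \<eta> m"
  have "(\<Sum>i<n. \<eta> i) \<le> (\<Sum>i\<le>n. \<eta> i)"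
    using c0_star_nonneg[OF \<eta>(1)] by (intro sum_mono2) auto
  then have "2 * (\<Sum>i<n. \<eta> i) \<le> (\<Sum>i\<le>k. \<eta> i)"
    using small sum_hat_index_ge[OF \<eta>, of m] by (simp add: k_def)
  then have "(\<Sum>i\<le>k. \<eta> i) \<le> 2 * (real (k + 1) * \<eta> n)"
    using sum_le_initial_plus[OF \<eta>(1), of k n] by simp
  then have "real (k + 1) * hat \<eta> m \<le> real (k + 1) * (2 * \<eta> n)"
    by (simp add: hat_def k_def sum_eq_amean algebra_simps)
  then have "hat \<eta> m \<le> 2 * \<eta> n" by (rule mult_left_le_imp_le) simp
  then have "b * hat \<eta> m \<le> b * (2 * \<eta> n)" using b(1) by (intro mult_left_mono) auto
  then show ?thesis using b(2)[of m] by simp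
qed

text \<open>As \<open>\<eta>\<close> has mean tending to 0, the previous lemma applies to \<open>m = n div M\<close> for every fixed \<open>M\<close> and large
  \<open>n\<close>. Going from \<open>n\<close> to \<open>n div M\<close> thus divides the length by \<open>M\<close> but multiplies \<open>\<eta>\<close> by at most
  \<open>2 * b\<close>. With \<open>M \<ge> 8 * b\<close> the sum up to \<open>n div M\<close> is, inductively, at most half of the bound
  \<open>K * (n + 1) * \<eta> n\<close>, and the terms beyond it make up the other half.\<close>

lemma regular_of_bigo_hat:
  assumes \<eta>: "\<eta> \<in> c0_star" "\<not> summable \<eta>"
    and b: "b > 0" "\<And>n. \<eta> n \<le> b * hat \<eta> n"
  shows "seq_bigo (amean \<eta>) \<eta>"
proof -
  note nn = c0_star_nonneg[OF \<eta>(1)]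
  note pos = pos_of_not_summable[OF \<eta>]
  obtain M :: nat where "max 2 (8 * b) < real M" using reals_Archimedean2 by blast
  then have M: "M \<ge> 2" "8 * b \<le> real M" by auto
  have "\<forall>\<^sub>F n in sequentially. amean \<eta> n < \<eta> 0 / (2 * real M)"
    using pos[of 0] M by (intro order_tendstoD[OF c0_star_tendsto[OF amean_in_c0_star[OF \<eta>(1)]]]) auto
  then obtain N0 where N0: "\<And>n. n \<ge> N0 \<Longrightarrow> amean \<eta> n < \<eta> 0 / (2 * real M)"
    by (auto simp: eventually_sequentially)
  define N where "N = max N0 M"
  have div_le: "real (n + 1) \<le> real M * real (n div M + 1)" for n
  proof -
    have "n + 1 \<le> M * (n div M + 1)"
      using dividend_less_times_div[of M n] M by simp
    then show ?thesis by (metis of_nat_le_iff of_nat_mult)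
  qed
  have slow: "\<eta> (n div M) \<le> 2 * b * \<eta> n" if "n \<ge> N" for n
  proof (rule le_of_bigo_hat[OF \<eta> b])
    have "2 * (\<Sum>i\<le>n. \<eta> i) \<le> 2 * (real (n + 1) * (\<eta> 0 / (2 * real M)))"
      unfolding sum_eq_amean using N0[of n] that by (intro mult_left_mono) (auto simp: N_def)
    also have "\<dots> = real (n + 1) * (\<eta> 0 / real M)" by simp
    also have "\<dots> \<le> real M * real (n div M + 1) * (\<eta> 0 / real M)"
      using div_le[of n] nn[of 0] by (intro mult_right_mono) auto
    also have "\<dots> = real (n div M + 1) * \<eta> 0" using M by simp
    finally show "2 * (\<Sum>i\<le>n. \<eta> i) \<le> real (n div M + 1) * \<eta> 0" .
  qed
  define K where "K = max (4 * b) (\<eta> 0 / \<eta> N)"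
  have K: "4 * b \<le> K" "\<eta> 0 / \<eta> N \<le> K" "K > 0" using b(1) by (auto simp: K_def)
  have "(\<Sum>i\<le>n. \<eta> i) \<le> K * (real (n + 1) * \<eta> n)" for n
  proof (induction n rule: less_induct)
    case (less n)
    show ?case
    proof (cases "n \<ge> N")
      case False
      have "\<eta> 0 \<le> K * \<eta> N" using K(2) pos[of N] by (simp add: field_simps)
      also have "\<dots> \<le> K * \<eta> n"
        using K(3) False by (intro mult_left_mono c0_star_antimono[OF \<eta>(1)]) auto
      finally have "real (n + 1) * \<eta> 0 \<le> real (n + 1) * (K * \<eta> n)" by (intro mult_left_mono) auto
      moreover have "(\<Sum>i\<le>n. \<eta> i) \<le> (\<Sum>i\<le>n. \<eta> 0)"
        by (intro sum_mono c0_star_antimono[OF \<eta>(1)]) auto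
      ultimately show ?thesis by (simp add: algebra_simps)
    next
      case True
      define d where "d = n div M"
      have "n \<ge> M" "n > 0" using True M by (auto simp: N_def)
      then have "d < n" using M by (simp add: d_def)
      have "d * M \<le> n" by (simp add: d_def)
      then have "(d + 1) * M \<le> 2 * (n + 1)" using \<open>n \<ge> M\<close> by simp
      then have dM: "real (d + 1) * real M \<le> 2 * real (n + 1)"
        by (metis of_nat_le_iff of_nat_mult of_nat_numeral)
      have "real (d + 1) * (8 * b) \<le> real (d + 1) * real M"
        using M by (intro mult_left_mono) auto
      moreover have "real (d + 1) * (8 * b) = 4 * (real (d + 1) * (2 * b))" by simp
      ultimately have db: "real (d + 1) * (2 * b) \<le> real (n + 1) / 2" using dM by linarith
      have "(\<Sum>i\<le>d. \<eta> i) \<le> K * (real (d + 1) * \<eta> d)" by (rule less.IH[OF \<open>d < n\<close>])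
      also have "\<dots> \<le> K * (real (d + 1) * (2 * b * \<eta> n))"
        using slow[OF True] K(3) by (intro mult_left_mono) (auto simp: d_def)
      also have "\<dots> = K * \<eta> n * (real (d + 1) * (2 * b))" by (simp add: algebra_simps)
      also have "\<dots> \<le> K * \<eta> n * (real (n + 1) / 2)"
        using db K(3) nn[of n] by (intro mult_left_mono) auto
      finally have S: "(\<Sum>i\<le>d. \<eta> i) \<le> K * (real (n + 1) * \<eta> n) / 2" by (simp add: algebra_simps)
      have "real (n + 1) * \<eta> d \<le> real (n + 1) * (2 * b * \<eta> n)"
        using slow[OF True] by (intro mult_left_mono) (auto simp: d_def)
      also have "\<dots> = 4 * b * (real (n + 1) * \<eta> n / 2)" by simp
      also have "\<dots> \<le> K * (real (n + 1) * \<eta> n / 2)"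
        using K(1) nn[of n] by (intro mult_right_mono) auto
      finally have T: "real (n + 1) * \<eta> d \<le> K * (real (n + 1) * \<eta> n) / 2" by simp
      have "(\<Sum>i<d. \<eta> i) \<le> (\<Sum>i\<le>d. \<eta> i)" using nn by (intro sum_mono2) auto
      then show ?thesis using sum_le_initial_plus[OF \<eta>(1), of n d] S T by linarith
    qed
  qed
  then have "amean \<eta> n \<le> K * \<eta> n" for n
    by (simp add: amean_def field_simps)
  then show ?thesis unfolding seq_bigo_def by blast
qed

text \<open>Put \<open>k = hat_index \<eta> n\<close>. The sum \<open>S\<close> of \<open>\<eta>\<close> up to \<open>k\<close> is at most \<open>C\<close> times that of \<open>amean \<zeta>\<close>. The
  first \<open>d\<close> terms of the latter contribute at most \<open>S/2\<close> if \<open>d\<close> is a small fraction of \<open>n\<close>, since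
  \<open>S \<ge> (n + 1) * \<eta> 0\<close>; the others are at most \<open>amean \<zeta> d\<close>. So the mean \<open>hat \<eta> n\<close> of \<open>\<eta>\<close> up to \<open>k\<close> is
  bounded by a multiple of \<open>amean \<zeta> d\<close>, which is comparable to \<open>amean \<zeta> n\<close>.\<close>

lemma bigo_amean_of_second_mean_ge_hat:
  assumes \<eta>: "\<eta> \<in> c0_star" "\<not> summable \<eta>"
    and b: "b > 0" "\<And>n. \<eta> n \<le> b * hat \<eta> n" and \<zeta>: "\<zeta> \<in> c0_star"
    and ge: "seq_bigo (amean (amean \<eta>)) (amean (amean \<zeta>))"
  shows "seq_bigo \<eta> (amean \<zeta>)"
proof -
  note nn = c0_star_nonneg[OF \<zeta>]
  note pos = pos_of_not_summable[OF \<eta>]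
  obtain C where C: "C > 0" "\<And>n. amean (amean \<eta>) n \<le> C * amean (amean \<zeta>) n"
    using seq_bigoE[OF ge] amean_in_c0_star \<zeta> by blast
  obtain M :: nat where "max 1 (2 * C * \<zeta> 0 / \<eta> 0) < real M" using reals_Archimedean2 by blast
  then have M: "M \<ge> 1" "2 * C * \<zeta> 0 \<le> real M * \<eta> 0" using pos[of 0] by (auto simp: field_simps)
  have "\<eta> n \<le> 2 * b * C * real M * amean \<zeta> n" for n
  proof -
    define k where "k = hat_index \<eta> n"
    define d where "d = (n + 1) div M"
    define S where "S = (\<Sum>i\<le>k. \<eta> i)"
    have S: "real (n + 1) * \<eta> 0 \<le> S" using sum_hat_index_ge[OF \<eta>, of n] by (simp add: S_def k_def)
    have "S \<le> (\<Sum>i\<le>k. amean \<eta> i)" unfolding S_def by (intro sum_mono le_amean \<eta>)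
    also have "\<dots> \<le> C * (\<Sum>i\<le>k. amean \<zeta> i)"
      using mult_left_mono[OF C(2)[of k], of "real (k + 1)"] by (simp add: sum_eq_amean mult.left_commute)
    also have "\<dots> \<le> C * (real d * \<zeta> 0 + real (k + 1) * amean \<zeta> d)"
      using sum_le_card_head_plus[OF amean_in_c0_star[OF \<zeta>], of k d] C(1) by (intro mult_left_mono) auto
    finally have S_le: "S \<le> C * \<zeta> 0 * real d + C * (real (k + 1) * amean \<zeta> d)"
      by (simp add: algebra_simps)
    have "d * M \<le> n + 1" by (simp add: d_def)
    then have dM: "real d * real M \<le> real (n + 1)" by (metis of_nat_le_iff of_nat_mult)
    have "2 * (C * \<zeta> 0 * real d) \<le> real M * \<eta> 0 * real d"
      using mult_right_mono[OF M(2), of "real d"] by simp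
    also have "\<dots> \<le> real (n + 1) * \<eta> 0"
      using mult_right_mono[OF dM, of "\<eta> 0"] pos[of 0] by (simp add: algebra_simps)
    finally have "S \<le> 2 * (C * (real (k + 1) * amean \<zeta> d))" using S S_le by linarith
    then have "real (k + 1) * hat \<eta> n \<le> real (k + 1) * (2 * C * amean \<zeta> d)"
      by (simp add: S_def hat_def k_def sum_eq_amean algebra_simps)
    then have "hat \<eta> n \<le> 2 * C * amean \<zeta> d" by (rule mult_left_le_imp_le) simp
    then have "b * hat \<eta> n \<le> b * (2 * C * amean \<zeta> d)" using b(1) by (intro mult_left_mono) auto
    then have 1: "\<eta> n \<le> 2 * b * C * amean \<zeta> d" using b(2)[of n] by simp
    have "amean \<zeta> d \<le> real M * amean \<zeta> n"
    proof (cases "d \<le> n")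
      case True
      have "n + 1 \<le> M * (d + 1)"
        using dividend_less_times_div[of M "n + 1"] M by (simp add: d_def)
      then have "real (n + 1) \<le> real M * real (d + 1)" by (metis of_nat_le_iff of_nat_mult)
      have "real (d + 1) * amean \<zeta> d \<le> real (n + 1) * amean \<zeta> n"
        using sum_atMost_mono[of \<zeta> d n] nn True by (simp add: sum_eq_amean)
      also have "\<dots> \<le> real M * real (d + 1) * amean \<zeta> n"
        using \<open>real (n + 1) \<le> real M * real (d + 1)\<close> nn by (intro mult_right_mono amean_nonneg) auto
      finally have "real (d + 1) * amean \<zeta> d \<le> real (d + 1) * (real M * amean \<zeta> n)"
        by (simp add: algebra_simps)
      then show ?thesis by (rule mult_left_le_imp_le) simp
    next
      case False
      then have "amean \<zeta> d \<le> amean \<zeta> n"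
        by (intro c0_star_antimono[OF amean_in_c0_star[OF \<zeta>]]) auto
      also have "\<dots> \<le> real M * amean \<zeta> n"
        using mult_right_mono[of 1 "real M" "amean \<zeta> n"] M nn by (simp add: amean_nonneg)
      finally show ?thesis .
    qed
    then have "2 * b * C * amean \<zeta> d \<le> 2 * b * C * (real M * amean \<zeta> n)"
      using b(1) C(1) by (intro mult_left_mono) auto
    with 1 show ?thesis by (simp add: algebra_simps)
  qed
  then show ?thesis unfolding seq_bigo_def by blast
qed

lemma equiv_hat_bigo:
  assumes "equiv_hat \<eta>"
  obtains b where "b > 0" "\<And>n. \<eta> n \<le> b * hat \<eta> n"
  using assms unfolding equiv_hat_def seq_equiv_def by blast

lemma amean_ge_of_second_mean_ge_hat:
  assumes \<eta>: "\<eta> \<in> c0_star" "equiv_hat \<eta>" and \<zeta>: "\<zeta> \<in> c0_star"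
    and ge: "seq_bigo (amean (amean \<eta>)) (amean (amean \<zeta>))"
  shows "seq_bigo (amean \<eta>) (amean \<zeta>)"
proof -
  have ns: "\<not> summable \<eta>" using \<eta>(2) by (simp add: equiv_hat_def)
  obtain b where b: "b > 0" "\<And>n. \<eta> n \<le> b * hat \<eta> n" using equiv_hat_bigo[OF \<eta>(2)] by blast
  show ?thesis
    using regular_of_bigo_hat[OF \<eta>(1) ns b] bigo_amean_of_second_mean_ge_hat[OF \<eta>(1) ns b \<zeta> ge] \<eta>(1)
    by (rule seq_bigo_trans)
qed

lemma equiv_hat_regular:
  assumes "\<eta> \<in> c0_star" "equiv_hat \<eta>"
  shows "seq_bigo (amean \<eta>) \<eta>"
proof -
  obtain b where b: "b > 0" "\<And>n. \<eta> n \<le> b * hat \<eta> n" using equiv_hat_bigo[OF assms(2)] by blast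
  have "\<not> summable \<eta>" using assms(2) by (simp add: equiv_hat_def)
  then show ?thesis using regular_of_bigo_hat[OF assms(1) _ b] by blast
qed

section \<open>Arithmetic mean of a set of sequences\<close>

text \<open>The characteristic set of \<open>am_ideal I\<close> in terms of that of \<open>I\<close>.\<close>

definition am_set :: "(nat \<Rightarrow> real) set \<Rightarrow> (nat \<Rightarrow> real) set" where
  "am_set S = {\<xi> \<in> c0_star. \<exists>\<eta>\<in>S. seq_bigo \<xi> (amean \<eta>)}"

lemma am_set_subset_c0_star: "am_set S \<subseteq> c0_star"
  by (auto simp: am_set_def)

lemma am_set_subsetI:
  assumes "S \<subseteq> c0_star" "\<And>\<eta>. \<eta> \<in> S \<Longrightarrow> \<exists>\<zeta>\<in>T. seq_bigo (amean \<eta>) (amean \<zeta>)"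
  shows "am_set S \<subseteq> am_set T"
proof
  fix \<xi> assume "\<xi> \<in> am_set S"
  then obtain \<eta> where "\<xi> \<in> c0_star" "\<eta> \<in> S" "seq_bigo \<xi> (amean \<eta>)" by (auto simp: am_set_def)
  moreover obtain \<zeta> where "\<zeta> \<in> T" "seq_bigo (amean \<eta>) (amean \<zeta>)" using assms(2) \<open>\<eta> \<in> S\<close> by blast
  ultimately show "\<xi> \<in> am_set T"
    using assms(1) seq_bigo_trans amean_in_c0_star unfolding am_set_def by blast
qed

lemma amean_in_am_set:
  assumes "S \<subseteq> c0_star" "\<eta> \<in> S"
  shows "amean \<eta> \<in> am_set S"
  using assms amean_in_c0_star seq_bigo_of_le[of "amean \<eta>" "amean \<eta>"] by (auto simp: am_set_def)

text \<open>Inclusion of second means is tested on the generating sequences \<open>\<eta>\<^sub>a\<^sub>a\<close>.\<close>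

lemma second_mean_bigo_of_am_set_subset:
  assumes "S \<subseteq> c0_star" "T \<subseteq> c0_star" "am_set (am_set S) \<subseteq> am_set (am_set T)" "\<eta> \<in> S"
  shows "\<exists>\<zeta>\<in>T. seq_bigo (amean (amean \<eta>)) (amean (amean \<zeta>))"
proof -
  have "amean (amean \<eta>) \<in> am_set (am_set S)"
    by (intro amean_in_am_set am_set_subset_c0_star assms)
  then have "amean (amean \<eta>) \<in> am_set (am_set T)" using assms(3) by (rule rev_subsetD)
  then obtain \<mu> where \<mu>: "\<mu> \<in> am_set T" "seq_bigo (amean (amean \<eta>)) (amean \<mu>)"
    unfolding am_set_def[of "am_set T"] by blast
  from \<mu>(1) obtain \<zeta> where \<zeta>: "\<mu> \<in> c0_star" "\<zeta> \<in> T" "seq_bigo \<mu> (amean \<zeta>)" by (auto simp: am_set_def)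
  have "seq_bigo (amean (amean \<eta>)) (amean (amean \<zeta>))"
    using \<mu>(2) seq_bigo_amean[OF \<zeta>(3)] amean_in_c0_star[OF \<zeta>(1)] by (rule seq_bigo_trans)
  then show ?thesis using \<zeta>(2) by blast
qed

text \<open>Here every comparison is with the single sequence \<open>\<eta>\<close>, so \<open>\<zeta>\<^sub>a\<^sub>a\<close> is available both as an upper and
  as a lower bound of \<open>\<eta>\<^sub>a\<^sub>a\<close> up to constants, as the regular case demands.\<close>

lemma am_set_cancel_principal:
  assumes \<eta>: "\<eta> \<in> c0_star" "ratio_equiv_log \<eta> \<or> seq_equiv \<eta> (amean \<eta>)"
    and S: "S = {\<xi> \<in> c0_star. \<exists>m\<ge>1. seq_bigo \<xi> (ampliation m \<eta>)}" and T: "T \<subseteq> c0_star"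
    and eq: "am_set (am_set T) = am_set (am_set S)"
  shows "am_set T = am_set S"
proof -
  have S_sub: "S \<subseteq> c0_star" using S by blast
  have "ampliation 1 \<eta> = \<eta>" by (rule ext) (simp add: ampliation_def)
  then have \<eta>S: "\<eta> \<in> S" using \<eta>(1) seq_bigo_of_le[of \<eta> \<eta>] unfolding S by force
  have S_le: "seq_bigo (amean \<xi>) (amean \<eta>)" if "\<xi> \<in> S" for \<xi>
  proof -
    from that obtain m where m: "m \<ge> 1" "seq_bigo \<xi> (ampliation m \<eta>)" "\<xi> \<in> c0_star" unfolding S by blast
    have "ampliation m \<eta> \<in> c0_star" by (rule ampliation_in_c0_star[OF \<eta>(1) m(1)])
    then show ?thesis
      using seq_bigo_amean[OF m(2)] amean_ampliation_bigo[OF \<eta>(1) m(1)] amean_in_c0_star seq_bigo_trans by blast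
  qed
  have regular: "seq_bigo (amean \<eta>) \<eta>" if "\<not> ratio_equiv_log \<eta>"
  proof -
    have "seq_equiv \<eta> (amean \<eta>)" using \<eta>(2) that by blast
    then obtain \<alpha> where \<alpha>: "\<alpha> > 0" "\<And>n. \<alpha> * amean \<eta> n \<le> \<eta> n"
      unfolding seq_equiv_def by blast
    then have "amean \<eta> n \<le> (1 / \<alpha>) * \<eta> n" for n by (simp add: field_simps)
    then show ?thesis unfolding seq_bigo_def by blast
  qed
  have T_second: "seq_bigo (amean (amean \<zeta>)) (amean (amean \<eta>))" if \<zeta>: "\<zeta> \<in> T" for \<zeta>
  proof -
    obtain \<mu> where \<mu>: "\<mu> \<in> S" "seq_bigo (amean (amean \<zeta>)) (amean (amean \<mu>))"
      using second_mean_bigo_of_am_set_subset[OF T S_sub _ \<zeta>] eq by blast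
    show ?thesis
      using \<mu>(2) seq_bigo_amean[OF S_le[OF \<mu>(1)]]
      by (rule seq_bigo_trans) (use \<mu>(1) S_sub in \<open>auto intro!: amean_in_c0_star\<close>)
  qed
  obtain \<zeta> where \<zeta>: "\<zeta> \<in> T" "seq_bigo (amean (amean \<eta>)) (amean (amean \<zeta>))"
    using second_mean_bigo_of_am_set_subset[OF S_sub T _ \<eta>S] eq by blast
  show ?thesis
  proof
    have "seq_bigo (amean \<zeta>') (amean \<eta>)" if "\<zeta>' \<in> T" for \<zeta>'
      using amean_le_of_second_mean_le_log[OF \<eta>(1)] amean_le_of_second_mean_le_regular[OF \<eta>(1) regular]
        T_second[OF that] that T by blast
    then show "am_set T \<subseteq> am_set S" using \<eta>S T by (intro am_set_subsetI) auto
    have ge: "seq_bigo (amean \<eta>) (amean \<zeta>)"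
      using amean_ge_of_second_mean_ge_log[OF \<eta>(1)] amean_ge_of_second_mean_equiv_regular[OF \<eta>(1) regular]
        T_second[OF \<zeta>(1)] \<zeta> T by blast
    have "seq_bigo (amean \<xi>) (amean \<zeta>)" if "\<xi> \<in> S" for \<xi>
      using S_le[OF that] ge amean_in_c0_star[OF \<eta>(1)] by (rule seq_bigo_trans)
    then show "am_set S \<subseteq> am_set T" using \<zeta>(1) S_sub by (intro am_set_subsetI) auto
  qed
qed

text \<open>Each inclusion uses one one-sided comparison. Enlarging the given sequence of \<open>S\<close> to a good one is
  harmless in both: it weakens an upper bound for \<open>\<zeta>\<^sub>a\<^sub>a\<close>, and \<open>\<xi> \<le> \<eta>\<close> passes to the first means.\<close>

lemma am_set_cancel_dominated:
  assumes S: "S \<subseteq> c0_star" and T: "T \<subseteq> c0_star"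
    and dom: "\<And>\<xi>. \<xi> \<in> S \<Longrightarrow> \<exists>\<eta>\<in>S. (\<forall>n. \<xi> n \<le> \<eta> n) \<and> (ratio_equiv_log \<eta> \<or> equiv_hat \<eta>)"
    and eq: "am_set (am_set T) = am_set (am_set S)"
  shows "am_set T = am_set S"
proof
  show "am_set T \<subseteq> am_set S"
  proof (rule am_set_subsetI[OF T])
    fix \<zeta> assume \<zeta>: "\<zeta> \<in> T"
    then obtain \<xi> where \<xi>: "\<xi> \<in> S" "seq_bigo (amean (amean \<zeta>)) (amean (amean \<xi>))"
      using second_mean_bigo_of_am_set_subset[OF T S] eq by blast
    obtain \<eta> where \<eta>: "\<eta> \<in> S" "\<And>n. \<xi> n \<le> \<eta> n" "ratio_equiv_log \<eta> \<or> equiv_hat \<eta>"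
      using dom[OF \<xi>(1)] by blast
    have "seq_bigo (amean (amean \<zeta>)) (amean (amean \<eta>))"
      using \<xi>(2) seq_bigo_amean[OF seq_bigo_amean[OF seq_bigo_of_le[OF \<eta>(2)]]]
      by (rule seq_bigo_trans) (use \<xi>(1) S in \<open>auto intro!: amean_in_c0_star\<close>)
    then have "seq_bigo (amean \<zeta>) (amean \<eta>)"
      using amean_le_of_second_mean_le_log amean_le_of_second_mean_le_regular equiv_hat_regular
        \<eta>(1,3) \<zeta> S T by blast
    then show "\<exists>\<eta>\<in>S. seq_bigo (amean \<zeta>) (amean \<eta>)" using \<eta>(1) by blast
  qed
  show "am_set S \<subseteq> am_set T"
  proof (rule am_set_subsetI[OF S])
    fix \<xi> assume "\<xi> \<in> S"
    then obtain \<eta> where \<eta>: "\<eta> \<in> S" "\<And>n. \<xi> n \<le> \<eta> n" "ratio_equiv_log \<eta> \<or> equiv_hat \<eta>"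
      using dom by blast
    obtain \<zeta> where \<zeta>: "\<zeta> \<in> T" "seq_bigo (amean (amean \<eta>)) (amean (amean \<zeta>))"
      using second_mean_bigo_of_am_set_subset[OF S T _ \<eta>(1)] eq by blast
    have "seq_bigo (amean \<eta>) (amean \<zeta>)"
      using amean_ge_of_second_mean_ge_log amean_ge_of_second_mean_ge_hat \<eta>(1,3) \<zeta> S T by blast
    with seq_bigo_amean[OF seq_bigo_of_le[OF \<eta>(2)]] have "seq_bigo (amean \<xi>) (amean \<zeta>)"
      by (rule seq_bigo_trans) (use \<eta>(1) S in \<open>auto intro: amean_in_c0_star\<close>)
    then show "\<exists>\<zeta>\<in>T. seq_bigo (amean \<xi>) (amean \<zeta>)" using \<zeta>(1) by blast
  qed
qed

lemma char_set_am_ideal: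
  assumes "separable_infinite_dimensional TYPE('h::complex_hilbert)"
  shows "char_set (am_ideal I :: ('h \<Rightarrow> 'h) set) = am_set (char_set I)"
  unfolding am_ideal_def am_set_def[symmetric]
  by (intro char_set_ideal_of assms am_set_subset_c0_star)

lemma am_ideal_eq_of_am_set_eq:
  "am_set (char_set J) = am_set (char_set I) \<Longrightarrow> am_ideal J = am_ideal I"
  by (simp add: am_ideal_def am_set_def)

theorem theorem4p8:
  assumes "separable_infinite_dimensional TYPE('h::complex_hilbert)"
  shows "(\<forall>(I :: ('h \<Rightarrow> 'h) set) (J :: ('h \<Rightarrow> 'h) set) (\<eta> :: nat \<Rightarrow> real).
            is_principal_ideal I \<eta> \<and> (ratio_equiv_log \<eta> \<or> seq_equiv \<eta> (amean \<eta>)) \<and>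
            proper_ideal J \<and> am_ideal (am_ideal J) = am_ideal (am_ideal I)
            \<longrightarrow> am_ideal J = am_ideal I)
       \<and> (\<forall>(I :: ('h \<Rightarrow> 'h) set) (J :: ('h \<Rightarrow> 'h) set).
            proper_ideal I \<and>
            (\<forall>\<xi>\<in>char_set I. \<exists>\<eta>\<in>char_set I. (\<forall>n. \<xi> n \<le> \<eta> n) \<and>
                (ratio_equiv_log \<eta> \<or> equiv_hat \<eta>)) \<and>
            proper_ideal J \<and> am_ideal (am_ideal J) = am_ideal (am_ideal I)
            \<longrightarrow> am_ideal J = am_ideal I)"
proof (intro conjI allI impI)
  have second: "am_set (am_set (char_set J)) = am_set (am_set (char_set I))"
    if "am_ideal (am_ideal J) = am_ideal (am_ideal I)" for I J :: "('h \<Rightarrow> 'h) set"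
    using arg_cong[OF that, of char_set] by (simp add: char_set_am_ideal[OF assms])
  show "am_ideal J = am_ideal I"
    if "is_principal_ideal I \<eta> \<and> (ratio_equiv_log \<eta> \<or> seq_equiv \<eta> (amean \<eta>)) \<and>
      proper_ideal J \<and> am_ideal (am_ideal J) = am_ideal (am_ideal I)"
    for I J :: "('h \<Rightarrow> 'h) set" and \<eta>
  proof (rule am_ideal_eq_of_am_set_eq, rule am_set_cancel_principal)
    show "\<eta> \<in> c0_star" "ratio_equiv_log \<eta> \<or> seq_equiv \<eta> (amean \<eta>)"
      "char_set I = {\<xi> \<in> c0_star. \<exists>m\<ge>1. seq_bigo \<xi> (ampliation m \<eta>)}"
      using that by (simp_all add: is_principal_ideal_def)
    show "am_set (am_set (char_set J)) = am_set (am_set (char_set I))"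
      using that by (intro second) blast
  qed (rule char_set_subset_c0_star)
  show "am_ideal J = am_ideal I"
    if "proper_ideal I \<and>
      (\<forall>\<xi>\<in>char_set I. \<exists>\<eta>\<in>char_set I. (\<forall>n. \<xi> n \<le> \<eta> n) \<and> (ratio_equiv_log \<eta> \<or> equiv_hat \<eta>)) \<and>
      proper_ideal J \<and> am_ideal (am_ideal J) = am_ideal (am_ideal I)"
    for I J :: "('h \<Rightarrow> 'h) set"
  proof (rule am_ideal_eq_of_am_set_eq, rule am_set_cancel_dominated)
    show "\<exists>\<eta>\<in>char_set I. (\<forall>n. \<xi> n \<le> \<eta> n) \<and> (ratio_equiv_log \<eta> \<or> equiv_hat \<eta>)"
      if "\<xi> \<in> char_set I" for \<xi>
      using \<open>proper_ideal I \<and> _\<close> that by blast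
    show "am_set (am_set (char_set J)) = am_set (am_set (char_set I))"
      using that by (intro second) blast
  qed (rule char_set_subset_c0_star)+
qed

end
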